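(* Let $n\ge 1$ be an integer and let $w\in\mathbb{C}W_n$ be given by $$w=\sum_{i=1}^n a_i\, s_{\{i\}}+\sum_{1\le i<j\le n} b_{ij}\,(ij),\qquad a_i\ge 0,\ b_{ij}\ge 0 .$$ Then $\psi_{W_n}(w)=\psi_{W_n}(w,\mathrm{P}_n)$.
   Context: $\mathfrak S_n$ is the symmetric group on $\{1,\dots,n\}$. $W_n=W(B_n)$ is the hyperoctahedral group, realized as the set of pairs $(\eta,\pi)$ with $\eta\in\{0,1\}^n$ and $\pi\in\mathfrak S_n$, with product $(\eta,\pi)\cdot(\zeta,\sigma)=(\eta+\zeta\circ\pi^{-1},\pi\sigma)$ (addition componentwise mod 2; elements of $\{0,1\}^n$ are regarded as functions $\{1,\dots,n\}\to\{0,1\}$). Equivalently, $W_n$ is the group of $n\times n$ matrices with exactly one nonzero entry in each row and column, that entry being $\pm1$, where $(\eta,\pi)$ corresponds to the matrix with entries $(-1)^{\eta_i}\delta_{i,\pi(j)}$. A permutation $\pi\in\mathfrak S_n$ is identified with $(0,\pi)\in W_n$; in particular the transposition $(ij)$ is regarded as an element of $W_n$. The element $s_{\{i\}}=(\eta_{\{i\}},1)$, with $(\eta_{\{i\}})_j=\delta_{ij}$, corresponds to the diagonal matrix with $-1$ in position $i$ and $1$ elsewhere. $\mathrm P_n$ is the $2n$-dimensional complex permutation representation of $W_n$ associated with its left action on $X_n=\{-n,\dots,-1\}\cup\{1,\dots,n\}$ given by $(\eta,\pi)k=(-1)^{\eta_{\pi(|k|)}}\,\mathrm{sgn}(k)\,\pi(|k|)$;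 i.e. $\mathrm P_n(g)e_k=e_{gk}$ on $\mathbb CX_n$. For a finite group $G$, $w=\sum_{g}w_g g\in\mathbb CG$ with $w_g\ge0$ and $w_{g^{-1}}=w_g$, and a finite-dimensional complex representation $R$ of $G$ on $V$, the representation Laplacian is $\Delta_G(w,R)=\sum_{h\in G}w_h\,[\mathrm{id}_V-R(h)]$. Its eigenvalues are real and nonnegative. An eigenvalue is called trivial if its eigenspace consists entirely of $G$-invariant vectors, and $\psi_G(w,R)$ is the smallest nontrivial eigenvalue of $\Delta_G(w,R)$ (with $\min\emptyset=+\infty$). The spectral gap of $w$ is $\psi_G(w)=\inf_R\psi_G(w,R)$ over all finite-dimensional complex representations $R$ of $G$; equivalently, $\psi_G(w)$ is the second smallest eigenvalue (counted with multiplicity) of the Laplacian of the weighted Cayley graph, $[\Delta f](g)=\sum_{h\in G}w_h\,(f(g)-f(hg))$ acting on functions $f:G\to\mathbb C$, i.e. $\psi_G(w)=\psi_G(w,L)$ with $L$ the left regular representation. *)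

theory Defs
  imports
    "Jordan_Normal_Form.Char_Poly"
    "HOL-Algebra.Group"
    "HOL-Combinatorics.Permutations"
    "HOL-Library.FuncSet"
    "HOL-Library.Extended_Real"
begin

section \<open>Representations and Laplacians of finite groups\<close>

text \<open>
  A finite-dimensional complex representation is given in coordinates: the space is \<open>\<complex>\<^sup>d\<close> with an
  arbitrary \<open>d\<close> (including \<open>d = 0\<close>), and the matrices act on column vectors.  The values of \<open>R\<close>
  outside the carrier of the group are irrelevant.
\<close>

definition representation :: "('g, 'r) monoid_scheme \<Rightarrow> nat \<Rightarrow> ('g \<Rightarrow> complex mat) \<Rightarrow> bool" where
  "representation G d R \<longleftrightarrow>
     (\<forall>g \<in> carrier G. R g \<in> carrier_mat d d) \<and>
     R \<one>\<^bsub>G\<^esub> = 1\<^sub>m d \<and>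
     (\<forall>g \<in> carrier G. \<forall>h \<in> carrier G. R (g \<otimes>\<^bsub>G\<^esub> h) = R g * R h)"

text \<open>
  Elements of the group algebra are functions giving the coefficients; \<open>basis_elt h\<close> is the group
  element \<open>h\<close> regarded as an element of the group algebra.
\<close>

definition basis_elt :: "'g \<Rightarrow> 'g \<Rightarrow> complex" where
  "basis_elt h = (\<lambda>g. if g = h then 1 else 0)"

text \<open>
  \<open>\<Sum>\<^bsub>h \<in> G\<^esub> w\<^sub>h (id - R(h))\<close>; the sum of matrices is written entrywise because \<open>mat\<close> is not an
  additive type class instance.
\<close>

definition laplacian ::
    "('g, 'r) monoid_scheme \<Rightarrow> ('g \<Rightarrow> complex) \<Rightarrow> nat \<Rightarrow> ('g \<Rightarrow> complex mat) \<Rightarrow> complex mat" where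
  "laplacian G w d R =
     mat d d (\<lambda>(i, j). \<Sum>h\<in>carrier G. w h * (1\<^sub>m d - R h) $$ (i, j))"

definition trivial_eigenvalue ::
    "('g, 'r) monoid_scheme \<Rightarrow> ('g \<Rightarrow> complex) \<Rightarrow> nat \<Rightarrow> ('g \<Rightarrow> complex mat) \<Rightarrow> complex \<Rightarrow> bool" where
  "trivial_eigenvalue G w d R k \<longleftrightarrow>
     eigenvalue (laplacian G w d R) k \<and>
     (\<forall>v. eigenvector (laplacian G w d R) v k \<longrightarrow> (\<forall>g \<in> carrier G. R g *\<^sub>v v = v))"

definition nontrivial_eigenvalues ::
    "('g, 'r) monoid_scheme \<Rightarrow> ('g \<Rightarrow> complex) \<Rightarrow> nat \<Rightarrow> ('g \<Rightarrow> complex mat) \<Rightarrow> real set" where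
  "nontrivial_eigenvalues G w d R =
     {x. eigenvalue (laplacian G w d R) (of_real x) \<and>
         \<not> trivial_eigenvalue G w d R (of_real x)}"

text \<open>
  The two definitions below are only meant for finite groups \<open>G\<close> and weights \<open>w\<close> that are real,
  nonnegative and invariant under inversion on \<open>G\<close>; then every eigenvalue of the Laplacian is
  real and nonnegative, so restricting to real eigenvalues above loses no eigenvalue.
  The set of nontrivial eigenvalues is always finite, so \<open>Min\<close> is meaningful.
\<close>

definition psi_rep ::
    "('g, 'r) monoid_scheme \<Rightarrow> ('g \<Rightarrow> complex) \<Rightarrow> nat \<Rightarrow> ('g \<Rightarrow> complex mat) \<Rightarrow> ereal" where
  "psi_rep G w d R =
     (if nontrivial_eigenvalues G w d R = {} then \<infinity>
      else ereal (Min (nontrivial_eigenvalues G w d R)))"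

definition psi :: "('g, 'r) monoid_scheme \<Rightarrow> ('g \<Rightarrow> complex) \<Rightarrow> ereal" where
  "psi G w = Inf {psi_rep G w d R | d R. representation G d R}"


section \<open>The hyperoctahedral group\<close>

text \<open>
  Sign vectors are functions \<open>{1..n} \<rightarrow> {0,1}\<close>, extended by \<open>undefined\<close> outside \<open>{1..n}\<close> so that
  equality of functions is equality on \<open>{1..n}\<close>; permutations of \<open>{1..n}\<close> are extended by the
  identity.
\<close>

definition hyperoctahedral :: "nat \<Rightarrow> ((nat \<Rightarrow> nat) \<times> (nat \<Rightarrow> nat)) monoid" where
  "hyperoctahedral n =
     \<lparr> carrier = ({1..n} \<rightarrow>\<^sub>E {0, 1}) \<times> {\<pi>. \<pi> permutes {1..n}},
       monoid.mult = (\<lambda>(\<eta>, \<pi>) (\<zeta>, \<sigma>).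
         (\<lambda>i\<in>{1..n}. (\<eta> i + \<zeta> (inv_into UNIV \<pi> i)) mod 2, \<pi> \<circ> \<sigma>)),
       one = (\<lambda>i\<in>{1..n}. 0, id) \<rparr>"

definition sign_flip :: "nat \<Rightarrow> nat \<Rightarrow> (nat \<Rightarrow> nat) \<times> (nat \<Rightarrow> nat)" where
  "sign_flip n i = (\<lambda>j\<in>{1..n}. if j = i then 1 else 0, id)"

definition of_perm :: "nat \<Rightarrow> (nat \<Rightarrow> nat) \<Rightarrow> (nat \<Rightarrow> nat) \<times> (nat \<Rightarrow> nat)" where
  "of_perm n \<pi> = (\<lambda>j\<in>{1..n}. 0, \<pi>)"

definition signed_action :: "(nat \<Rightarrow> nat) \<times> (nat \<Rightarrow> nat) \<Rightarrow> int \<Rightarrow> int" where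
  "signed_action = (\<lambda>(\<eta>, \<pi>) k.
     (-1) ^ \<eta> (\<pi> (nat \<bar>k\<bar>)) * sgn k * int (\<pi> (nat \<bar>k\<bar>)))"

text \<open>
  The increasing enumeration of \<open>X\<^sub>n = {-n, \<dots>, -1} \<union> {1, \<dots>, n}\<close> by the matrix indices
  \<open>0, \<dots>, 2n - 1\<close>.
\<close>

definition signed_point :: "nat \<Rightarrow> nat \<Rightarrow> int" where
  "signed_point n i = (if i < n then int i - int n else int i - int n + 1)"

text \<open>Column \<open>j\<close> is the basis vector belonging to the image of the \<open>j\<close>-th point of \<open>X\<^sub>n\<close>.\<close>

definition signed_perm_rep :: "nat \<Rightarrow> (nat \<Rightarrow> nat) \<times> (nat \<Rightarrow> nat) \<Rightarrow> complex mat" where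
  "signed_perm_rep n g =
     mat (2 * n) (2 * n) (\<lambda>(i, j).
       if signed_point n i = signed_action g (signed_point n j) then 1 else 0)"

end

theory Submission
  imports Defs "HOL-Analysis.Function_Topology" "HOL-Analysis.L2_Norm"
begin

text \<open>
  A matrix coefficient of an eigenvector turns a nontrivial eigenvalue \<open>x\<close> of any representation into
  a nonconstant real eigenfunction \<open>f\<close> of the Cayley graph Laplacian.  Suppose first that \<open>f\<close> is not
  invariant under all sign flips, and let \<open>y i\<close> be the norm of the part of \<open>f\<close> that is odd under the
  \<open>i\<close>-th flip.  Pairing the eigenvalue equation with the sum of these parts bounds the energy of \<open>y\<close> for
  the random walk killed at rate \<open>2 a i\<close> by \<open>x * |y|\<^sup>2\<close>, and that walk is the odd part of \<open>P\<^sub>n\<close>.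

  If \<open>f\<close> is invariant under sign flips, it lives on the symmetric group and \<open>x\<close> is bounded below by
  the gap of the random walk, which is the even part of \<open>P\<^sub>n\<close>; this is Aldous' spectral gap
  conjecture, proved by Caputo, Liggett and Richthammer.  Its proof removes one vertex \<open>n\<close> and
  replaces the weights by \<open>b i j + b n i * b n j / sum (b n) S\<close>: the random walk gap does not decrease
  by harmonic extension, and the energy on permutations does not increase by the octopus inequality.

  The octopus inequality says that \<open>M = \<Sum>i j. e i * e j * (i j)\<close>, with \<open>(i i) = 1\<close>, is positive
  semidefinite in the group algebra whenever the weights \<open>e\<close> have sum zero and at most one is
  negative.  Expanding \<open>M\<^sup>2\<close> gives
  \<open>12 * (\<Sum>i. (e i)\<^sup>2) * M = 6 * M\<^sup>2 - \<Sum>i j k l. e i * e j * e k * e l * B i j k l\<close>,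
  where the sum is over distinct indices and \<open>B i j k l\<close> is positive semidefinite in the group algebra
  of the alternating group on four letters.  The sign of the last sum is settled by an inequality
  between the five such elements on five letters.
\<close>

section \<open>Minimisers of Rayleigh quotients\<close>

text \<open>By compactness the quadratic form of \<open>L\<close> attains its minimum on the unit
  sphere orthogonal to \<open>e\<close>; the first variation in the direction of the residual makes
  the minimiser an eigenvector. If \<open>e\<close> is zero, the orthogonality condition is
  void.\<close>

lemma Rayleigh_minimiser:
  fixes A :: "'a set" and L :: "('a \<Rightarrow> real) \<Rightarrow> 'a \<Rightarrow> real" and e :: "'a \<Rightarrow> real"
  assumes "finite A"
    and lin: "\<And>x y t i. L (\<lambda>j. x j + t * y j) i = L x i + t * L y i"
    and cont: "\<And>i. i \<in> A \<Longrightarrow> continuous_on UNIV (\<lambda>x. L x i)"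
    and sym: "\<And>x y. (\<Sum>i\<in>A. x i * L y i) = (\<Sum>i\<in>A. L x i * y i)"
    and eig: "\<And>i. i \<in> A \<Longrightarrow> L e i = k * e i"
    and z: "(\<Sum>i\<in>A. z i * e i) = 0" "\<exists>i\<in>A. z i \<noteq> 0"
  obtains \<mu> x where "\<exists>i\<in>A. x i \<noteq> 0" "(\<Sum>i\<in>A. x i * e i) = 0"
    "\<And>i. i \<in> A \<Longrightarrow> L x i = \<mu> * x i"
    "\<And>y. (\<Sum>i\<in>A. y i * e i) = 0 \<Longrightarrow> \<mu> * (\<Sum>i\<in>A. (y i)\<^sup>2) \<le> (\<Sum>i\<in>A. y i * L y i)"
proof -
  define N where "N x = (\<Sum>i\<in>A. (x i)\<^sup>2)" for x :: "'a \<Rightarrow> real"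
  define q where "q x = (\<Sum>i\<in>A. x i * L x i)" for x
  define F where "F x = (\<Sum>i\<in>A. x i * e i)" for x :: "'a \<Rightarrow> real"
  define K where "K = {x. (\<forall>i. i \<notin> A \<longrightarrow> x i = 0) \<and> N x = 1 \<and> F x = 0}"
  \<comment> \<open>Putting the value 0 outside \<open>A\<close> places the unit sphere inside a
    product of compact intervals over the whole index type, which is compact by Tychonoff.\<close>
  define box where "box = (\<Pi>\<^sub>E i\<in>UNIV. if i \<in> A then {-1..1} else {0::real})"
  have coord: "continuous_on UNIV (\<lambda>x::'a \<Rightarrow> real. x i)" for i
    by (rule continuous_on_product_coordinates)
  have cN: "continuous_on UNIV N" and cF: "continuous_on UNIV F" and cq: "continuous_on UNIV q"
    unfolding N_def F_def q_def by (intro continuous_intros coord cont; assumption)+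
  have "compact box"
    unfolding box_def compactin_euclidean_iff[symmetric] euclidean_product_topology[symmetric]
      compactin_PiE by simp
  moreover have "closed ({x. \<forall>i. i \<notin> A \<longrightarrow> x i = 0} \<inter> (N -` {1} \<inter> F -` {0}))"
  proof (intro closed_Int closed_vimage cN cF)
    have "{x::'a \<Rightarrow> real. \<forall>i. i \<notin> A \<longrightarrow> x i = 0} = (\<Inter>i\<in>-A. (\<lambda>x. x i) -` {0})"
      by auto
    then show "closed {x::'a \<Rightarrow> real. \<forall>i. i \<notin> A \<longrightarrow> x i = 0}"
      by (auto intro!: closed_vimage coord)
  qed auto
  moreover have "K = box \<inter> ({x. \<forall>i. i \<notin> A \<longrightarrow> x i = 0} \<inter> (N -` {1} \<inter> F -` {0}))"
  proof -
    have "\<bar>x i\<bar> \<le> 1" if "N x = 1" "i \<in> A" for x i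
      using member_le_sum[of i A "\<lambda>i. (x i)\<^sup>2"] that \<open>finite A\<close>
      by (simp add: N_def abs_square_le_1)
    then show ?thesis by (fastforce simp: K_def box_def abs_le_iff)
  qed
  ultimately have "compact K"
    by (simp only: compact_Int_closed)
  have Nnn: "N x \<ge> 0" for x unfolding N_def by (simp add: sum_nonneg)
  have N0: "N x = 0 \<longleftrightarrow> (\<forall>i\<in>A. x i = 0)" for x
    unfolding N_def using \<open>finite A\<close> by (simp add: sum_nonneg_eq_0_iff)
  have Lscale: "L (\<lambda>j. t * y j) i = t * L y i" for t y i
    using lin[of "\<lambda>j. 0" t y i] lin[of "\<lambda>j. 0" 1 "\<lambda>j. 0" i] by simp
  \<comment> \<open>Testing symmetry against the indicator of \<open>i\<close> turns
    \<open>L\<close> into a matrix on \<open>A\<close>, so values outside \<open>A\<close> cannot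
    influence it.\<close>
  have L_cong: "L x i = L y i" if "i \<in> A" "\<And>j. j \<in> A \<Longrightarrow> x j = y j" for x y i
  proof -
    define d where "d = (\<lambda>j. if j = i then 1 else 0::real)"
    have *: "L v i = (\<Sum>j\<in>A. L d j * v j)" for v
    proof -
      have "(\<Sum>j\<in>A. d j * L v j) = (\<Sum>j\<in>A. if j = i then L v j else 0)"
        by (intro sum.cong) (simp_all add: d_def)
      then show ?thesis using sym[of d v] \<open>finite A\<close> \<open>i \<in> A\<close> by simp
    qed
    show ?thesis unfolding *[of x] *[of y] by (intro sum.cong) (simp_all add: that)
  qed
  have norm: "\<exists>x\<in>K. q y = N y * q x" if "F y = 0" "N y \<noteq> 0" for y
  proof -
    define c where "c = 1 / sqrt (N y)"
    define x where "x = (\<lambda>j. if j \<in> A then c * y j else 0)"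
    have Lx: "L x i = c * L y i" if "i \<in> A" for i
      using L_cong[of i x "\<lambda>j. c * y j"] that by (simp add: x_def Lscale)
    have s: "c\<^sup>2 = 1 / N y" using Nnn[of y] by (simp add: c_def power_divide)
    have "N x = c\<^sup>2 * N y"
      unfolding N_def[of x] N_def[THEN arg_cong, of "\<lambda>r. c\<^sup>2 * r" y] sum_distrib_left
      by (intro sum.cong) (simp_all only: x_def power_mult_distrib if_True)
    moreover have "F x = c * F y"
      unfolding F_def by (simp add: x_def sum_distrib_left mult.assoc)
    moreover have "q x = c\<^sup>2 * q y"
      unfolding q_def sum_distrib_left
          by (intro sum.cong) (simp_all add: Lx, simp add: x_def power2_eq_square)
    ultimately show ?thesis
      using that s by (intro bexI[of _ x]) (auto simp: K_def x_def)
  qed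
  have "K \<noteq> {}" using norm[of z] z N0[of z] by (auto simp: F_def)
  then obtain x where x: "x \<in> K" and min: "\<And>y. y \<in> K \<Longrightarrow> q x \<le> q y"
    using continuous_attains_inf[OF \<open>compact K\<close> _ continuous_on_subset[OF cq]]
        by (metis subset_UNIV)
  have qge: "q x * N y \<le> q y" if "F y = 0" for y
  proof (cases "N y = 0")
    case True
    then have "q y = 0" using N0 by (simp add: q_def)
    then show ?thesis using True by simp
  next
    case False
    then show ?thesis using norm[OF that False] min Nnn[of y]
        by (metis mult.commute mult_right_mono)
  qed
  \<comment> \<open>The residual is orthogonal to \<open>e\<close>, because \<open>L\<close> is
    symmetric and \<open>e\<close> is an eigenvector; hence it is an admissible direction of
    variation.\<close>
  define r where "r = (\<lambda>i. L x i - q x * x i)"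
  have x1: "N x = 1" "F x = 0" using x by (auto simp: K_def)
  have "F (L x) = (\<Sum>i\<in>A. x i * L e i)"
    using sym[of x e] by (simp add: F_def)
  also have "\<dots> = k * F x"
    using eig by (simp add: F_def sum_distrib_left mult.left_commute)
  finally have Fr: "F r = 0"
    using x1 by (simp add: r_def F_def left_diff_distrib sum_subtractf mult.assoc sum_distrib_left[symmetric])
  have main: "0 \<le> 2 * t * N r + t\<^sup>2 * (q r - q x * N r)" for t
  proof -
    let ?y = "\<lambda>j. x j + t * r j"
    define P where "P = (\<Sum>i\<in>A. L x i * r i)"
    define R where "R = (\<Sum>i\<in>A. x i * r i)"
    have "F ?y = 0" using x1 Fr
      by (simp add: F_def distrib_right sum.distrib mult.assoc sum_distrib_left[symmetric])
    then have "q x * N ?y \<le> q ?y" by (rule qge)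
    moreover have "q ?y = q x + 2 * t * (\<Sum>i\<in>A. L x i * r i) + t\<^sup>2 * q r"
    proof -
      have "q ?y = q x + t * (\<Sum>i\<in>A. x i * L r i) + t * (\<Sum>i\<in>A. L x i * r i) + t\<^sup>2 * q r"
        unfolding q_def lin by (simp add: algebra_simps sum.distrib sum_distrib_left power2_eq_square)
      then show ?thesis by (simp add: sym)
    qed
    moreover have "N ?y = N x + 2 * t * (\<Sum>i\<in>A. x i * r i) + t\<^sup>2 * N r"
      unfolding N_def by (simp add: algebra_simps sum.distrib sum_distrib_left power2_eq_square)
    moreover have "N r = (\<Sum>i\<in>A. L x i * r i) - q x * (\<Sum>i\<in>A. x i * r i)"
      unfolding N_def sum_distrib_left sum_subtractf[symmetric]
      by (intro sum.cong) (simp_all add: r_def power2_eq_square algebra_simps)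
    ultimately have *: "q x * (1 + 2 * t * R + t\<^sup>2 * N r) \<le> q x + 2 * t * P + t\<^sup>2 * q r"
      and Nr: "N r = P - q x * R"
      using x1 by (simp_all only: P_def R_def)
    have "q x + 2 * t * P + t\<^sup>2 * q r - q x * (1 + 2 * t * R + t\<^sup>2 * N r)
        = 2 * t * (P - q x * R) + t\<^sup>2 * (q r - q x * N r)"
      by (simp add: algebra_simps)
    then show ?thesis using * unfolding Nr[symmetric] by (metis diff_ge_0_iff_ge)
  qed
  have "N r = 0"
  proof (rule ccontr)
    assume "N r \<noteq> 0"
    then have pos: "N r > 0" using Nnn[of r] by simp
    \<comment> \<open>At \<open>t = - N r / c\<close>, with \<open>c\<close> at least the quadratic
      coefficient, the linear term of \<open>main\<close> wins and the bound becomes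
      negative.\<close>
    define c where "c = \<bar>q r - q x * N r\<bar> + 1"
    have c: "c > 0" "q r - q x * N r \<le> c" by (auto simp: c_def)
    have "0 \<le> 2 * (- N r / c) * N r + (- N r / c)\<^sup>2 * (q r - q x * N r)" by (rule main)
    also have "\<dots> \<le> 2 * (- N r / c) * N r + (- N r / c)\<^sup>2 * c"
      using c by (intro add_left_mono mult_left_mono) auto
    also have "\<dots> = - (N r)\<^sup>2 / c" using c by (simp add: field_simps power2_eq_square)
    also have "\<dots> < 0" using pos c by simp
    finally show False by simp
  qed
  then have "L x i = q x * x i" if "i \<in> A" for i
    using N0 that by (auto simp: r_def)
  moreover have "\<exists>i\<in>A. x i \<noteq> 0" using N0[of x] x1(1) by auto
  ultimately show ?thesis
    using that[of x "q x"] qge x1 by (simp add: F_def N_def q_def)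
qed

section \<open>The octopus inequality\<close>

abbreviation (input) tr :: "'a \<Rightarrow> 'a \<Rightarrow> 'a \<Rightarrow> 'a" where "tr \<equiv> Transposition.transpose"

text \<open>
  With \<open>\<pi>\<close> varying over a coset of the alternating group on four letters, \<open>omega_part\<close> is twelve times the
  projection onto its two nontrivial linear characters.
\<close>

definition omega_part :: "('b \<Rightarrow> 'b \<Rightarrow> 'b \<Rightarrow> 'b \<Rightarrow> real) \<Rightarrow> 'b \<Rightarrow> 'b \<Rightarrow> 'b \<Rightarrow> 'b \<Rightarrow> real" where
  "omega_part F p q r s = 2 * F p q r s + 2 * (F q p s r + F r s p q + F s r q p)
     - (F q r p s + F r p q s + F q s r p + F s p r q + F r q s p + F s q p r + F p r s q
         + F p s q r)"

lemma omega_part_omega_part: "omega_part (omega_part F) p q r s = 12 * omega_part F p q r s"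
  unfolding omega_part_def by simp

text \<open>
  Among the irreducible representations of the alternating group on five letters, only the
  five-dimensional one contains a nontrivial linear character of the point stabilisers.  By Schur's
  lemma the sum of the five projections is therefore twice the projection onto that isotypic component.
\<close>

lemma omega_part_five:
  assumes U: "\<And>p q r s t. U p q r s t = omega_part (\<lambda>p q r s. F p q r s t) p q r s"
  shows "omega_part (\<lambda>p q r t. U p q r s t) p q r t + omega_part (\<lambda>p q s t. U p q r s t) p q s t
    + omega_part (\<lambda>p r s t. U p q r s t) p r s t + omega_part (\<lambda>q r s t. U p q r s t) q r s t = 12
        * U p q r s t"
  unfolding omega_part_def U by simp

text \<open>Right multiplication of a permutation by the alternating group on the positions
  \<open>i j k l\<close> permutes the four values there. Overwriting these values reduces operator
  identities to identities between functions of four arguments.\<close>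

definition omega_op :: "'a \<Rightarrow> 'a \<Rightarrow> 'a \<Rightarrow> 'a \<Rightarrow> (('a \<Rightarrow> 'b) \<Rightarrow> real) \<Rightarrow> ('a \<Rightarrow> 'b) \<Rightarrow> real" where
  "omega_op i j k l f \<pi>
      = omega_part (\<lambda>p q r s. f (\<pi>(i := p, j := q, k := r, l := s))) (\<pi> i) (\<pi> j) (\<pi> k) (\<pi> l)"

lemma omega_op_upd:
  assumes "distinct [i, j, k, l]"
  shows "omega_op i j k l f (\<pi>(i := p, j := q, k := r, l := s))
    = omega_part (\<lambda>p q r s. f (\<pi>(i := p, j := q, k := r, l := s))) p q r s"
  unfolding omega_op_def omega_part_def using assms by (simp add: fun_upd_twist)

lemma omega_op_omega_op:
  assumes "distinct [i, j, k, l]"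
  shows "omega_op i j k l (omega_op i j k l f) \<pi> = 12 * omega_op i j k l f \<pi>"
proof -
  have "omega_op i j k l (omega_op i j k l f) \<pi>
      = omega_part (omega_part (\<lambda>p q r s. f (\<pi>(i := p, j := q, k := r, l := s)))) (\<pi> i) (\<pi> j) (\<pi> k) (\<pi> l)"
    by (subst omega_op_def) (simp only: omega_op_upd[OF assms])
  then show ?thesis by (simp add: omega_part_omega_part omega_op_def)
qed

text \<open>With the values outside the five positions frozen, everything is a function of five
  arguments. The operator of \<open>i j k l\<close> itself would contribute another
  \<open>12 * u\<close>, in accordance with twice the isotypic projection.\<close>

lemma omega_op_five:
  fixes f :: "('a \<Rightarrow> 'b) \<Rightarrow> real"
  assumes "distinct [i, j, k, l, m]"
  defines "u \<equiv> omega_op i j k l f"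
  shows "omega_op i j k m u \<pi> + omega_op i j l m u \<pi> + omega_op i k l m u \<pi> + omega_op j k l m u \<pi>
      = 12 * u \<pi>"
proof -
  define W where "W p q r s t = f (\<pi>(m := t, i := p, j := q, k := r, l := s))" for p q r s t
  define U where "U p q r s t = u (\<pi>(m := t, i := p, j := q, k := r, l := s))" for p q r s t
  have U: "U p q r s t = omega_part (\<lambda>p q r s. W p q r s t) p q r s" for p q r s t
    unfolding U_def W_def u_def using assms by (intro omega_op_upd) auto
  have upd: "\<pi>(i := p, j := q, k := r, m := t) = \<pi>(m := t, i := p, j := q, k := r, l := \<pi> l)"
    "\<pi>(i := p, j := q, l := s, m := t) = \<pi>(m := t, i := p, j := q, k := \<pi> k, l := s)"
    "\<pi>(i := p, k := r, l := s, m := t) = \<pi>(m := t, i := p, j := \<pi> j, k := r, l := s)"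
    "\<pi>(j := q, k := r, l := s, m := t) = \<pi>(m := t, i := \<pi> i, j := q, k := r, l := s)" for p q r s t
    using assms(1) by (auto simp: fun_eq_iff)
  have "omega_op i j k m u \<pi> = omega_part (\<lambda>p q r t. U p q r (\<pi> l) t) (\<pi> i) (\<pi> j) (\<pi> k) (\<pi> m)"
    "omega_op i j l m u \<pi> = omega_part (\<lambda>p q s t. U p q (\<pi> k) s t) (\<pi> i) (\<pi> j) (\<pi> l) (\<pi> m)"
    "omega_op i k l m u \<pi> = omega_part (\<lambda>p r s t. U p (\<pi> j) r s t) (\<pi> i) (\<pi> k) (\<pi> l) (\<pi> m)"
    "omega_op j k l m u \<pi> = omega_part (\<lambda>q r s t. U (\<pi> i) q r s t) (\<pi> j) (\<pi> k) (\<pi> l) (\<pi> m)"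
    unfolding omega_op_def U_def upd by (rule refl)+
  moreover have "u \<pi> = U (\<pi> i) (\<pi> j) (\<pi> k) (\<pi> l) (\<pi> m)"
    by (simp add: U_def)
  ultimately show ?thesis using omega_part_five[OF U] by simp
qed

text \<open>Conjugation by an odd permutation exchanges the two nontrivial linear characters of the
  alternating group, so their joint projection is invariant under the full symmetric group on the
  four indices.\<close>

lemma omega_op_swap:
  assumes "distinct [i, j, k, l]"
  shows "omega_op j i k l f = omega_op i j k l f" "omega_op i k j l f = omega_op i j k l f"
      "omega_op i j l k f = omega_op i j k l f"
  using assms by (auto simp: omega_op_def omega_part_def fun_upd_twist fun_eq_iff)

text \<open>Words in two transpositions make inverses visible: the inverse of an element is its
  reversed word.\<close>

lemma omega_op_word:
  assumes "distinct [i, j, k, l]"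
  shows "omega_op i j k l f \<pi> = 2 * f \<pi>
    + 2 * (f (\<pi> \<circ> tr i j \<circ> tr k l) + f (\<pi> \<circ> tr i k \<circ> tr j l) + f (\<pi> \<circ> tr i l \<circ> tr j k))
    - (f (\<pi> \<circ> tr i j \<circ> tr j k) + f (\<pi> \<circ> tr j k \<circ> tr i j) + f (\<pi> \<circ> tr i j \<circ> tr j l)
        + f (\<pi> \<circ> tr j l \<circ> tr i j)
      + f (\<pi> \<circ> tr i k \<circ> tr k l) + f (\<pi> \<circ> tr k l \<circ> tr i k) + f (\<pi> \<circ> tr j k \<circ> tr k l)
          + f (\<pi> \<circ> tr k l \<circ> tr j k))"
proof -
  have f: "f \<rho> = f \<sigma>" if "\<And>x. x \<notin> {i,j,k,l} \<Longrightarrow> \<rho> x = \<sigma> x" "\<rho> i = \<sigma> i" "\<rho> j = \<sigma> j" "\<rho> k = \<sigma> k" "\<rho> l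
      = \<sigma> l" for \<rho> \<sigma>
    using that by (intro arg_cong[where f = f] ext) (metis empty_iff insert_iff)
  show ?thesis
    unfolding omega_op_def omega_part_def
    by (intro arg_cong2[where f = "(+)"] arg_cong2[where f = "(-)"] arg_cong2[where f =
        "(*)"] refl f)
      (use assms in \<open>auto simp: Transposition.transpose_def\<close>)
qed

section \<open>Adjoints and positivity on the symmetric group\<close>

lemma sum_perm_tr:
  assumes "i \<in> S" "j \<in> S"
  shows "(\<Sum>\<pi> | \<pi> permutes S. F (\<pi> \<circ> tr i j)) = (\<Sum>\<pi> | \<pi> permutes S. F \<pi>)"
  by (rule sum.reindex_bij_witness[of _ "\<lambda>\<pi>. \<pi> \<circ> tr i j" "\<lambda>\<pi>. \<pi> \<circ> tr i j"])
    (auto simp: comp_assoc intro: permutes_compose permutes_swap_id[OF assms])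

lemma sum_perm_adj:
  assumes "i \<in> S" "j \<in> S"
  shows "(\<Sum>\<pi> | \<pi> permutes S. f \<pi> * g (\<pi> \<circ> tr i j)) = (\<Sum>\<pi> | \<pi> permutes S. f (\<pi> \<circ> tr i j)
      * (g \<pi>::real))"
  using sum_perm_tr[OF assms, of "\<lambda>\<pi>. f (\<pi> \<circ> tr i j) * g \<pi>"] by (simp add: comp_assoc)

lemma sum_perm_adj2:
  assumes "i \<in> S" "j \<in> S" "k \<in> S" "l \<in> S"
  shows "(\<Sum>\<pi> | \<pi> permutes S. f \<pi> * g (\<pi> \<circ> tr i j \<circ> tr k l))
      = (\<Sum>\<pi> | \<pi> permutes S. f (\<pi> \<circ> tr k l \<circ> tr i j) * (g \<pi>::real))"
  using sum_perm_adj[of i S j f "\<lambda>\<pi>. g (\<pi> \<circ> tr k l)"] sum_perm_adj[of k S l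
      "\<lambda>\<pi>. f (\<pi> \<circ> tr i j)" g] assms by simp

lemma tr_comm: "distinct [i,j,k,l] \<Longrightarrow> \<pi> \<circ> tr i j \<circ> tr k l = \<pi> \<circ> tr k l \<circ> tr i j"
  by (auto simp: fun_eq_iff Transposition.transpose_def)

text \<open>Inverse elements have equal coefficients: the three-cycles occur in inverse pairs and
  the double transpositions are involutions.\<close>

lemma omega_op_adj:
  assumes "distinct [i, j, k, l]" "i \<in> S" "j \<in> S" "k \<in> S" "l \<in> S"
  shows "(\<Sum>\<pi> | \<pi> permutes S. f \<pi> * omega_op i j k l g \<pi>)
      = (\<Sum>\<pi> | \<pi> permutes S. omega_op i j k l f \<pi> * g \<pi>)"
proof -
  have "f (\<pi> \<circ> tr k l \<circ> tr i j) = f (\<pi> \<circ> tr i j \<circ> tr k l)" "f (\<pi> \<circ> tr j l \<circ> tr i k)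
      = f (\<pi> \<circ> tr i k \<circ> tr j l)"
    "f (\<pi> \<circ> tr j k \<circ> tr i l) = f (\<pi> \<circ> tr i l \<circ> tr j k)" for \<pi>
    using assms(1) by (intro arg_cong[where f = f] tr_comm; auto)+
  then show ?thesis
    unfolding omega_op_word[OF assms(1)] using assms(2-)
    by (simp add: distrib_left distrib_right left_diff_distrib right_diff_distrib mult.left_commute[of _ 2] mult.assoc
        sum.distrib sum_subtractf sum_distrib_left[symmetric] sum_perm_adj2)
qed

text \<open>The value 0 at coinciding indices lets weighted sums run over all quadruples.\<close>

definition omega_form where
  "omega_form S f i j k l = (if distinct [i, j, k, l] then \<Sum>\<pi> | \<pi> permutes S. f \<pi>
      * omega_op i j k l f \<pi> else 0)"

text \<open>The operator is self-adjoint and its square is twelve times itself, so the form is one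
  twelfth of the squared norm of \<open>omega_op i j k l f\<close>.\<close>

lemma omega_form_nonneg:
  assumes "i \<in> S" "j \<in> S" "k \<in> S" "l \<in> S"
  shows "omega_form S f i j k l \<ge> 0"
proof (cases "distinct [i, j, k, l]")
  case True
  have "12 * (\<Sum>\<pi> | \<pi> permutes S. f \<pi> * omega_op i j k l f \<pi>) = (\<Sum>\<pi> | \<pi> permutes S. f \<pi>
      * omega_op i j k l (omega_op i j k l f) \<pi>)"
    by (simp add: omega_op_omega_op[OF True] sum_distrib_left algebra_simps)
  also have "\<dots> = (\<Sum>\<pi> | \<pi> permutes S. omega_op i j k l f \<pi> * omega_op i j k l f \<pi>)"
    by (rule omega_op_adj[OF True assms])
  also have "\<dots> \<ge> 0" by (simp add: sum_nonneg)
  finally show ?thesis by (simp add: omega_form_def)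
qed (auto simp: omega_form_def)

lemma omega_form_swap:
  "omega_form S f j i k l = omega_form S f i j k l" "omega_form S f i k j l
      = omega_form S f i j k l"
  "omega_form S f i j l k = omega_form S f i j k l"
  using omega_op_swap[of i j k l f] by (auto simp: omega_form_def)

lemma omega_op_lin: "omega_op i j k l (\<lambda>\<pi>. f \<pi> + c * g \<pi>) \<pi> = omega_op i j k l f \<pi> + c
    * omega_op i j k l g \<pi>"
  by (simp add: omega_op_def omega_part_def algebra_simps)

text \<open>The sum \<open>C\<close> of the four operators that involve \<open>m\<close> is positive
  semidefinite and maps \<open>u = omega_op i j k l f\<close> to \<open>12 * u\<close>. Evaluating
  its form at \<open>f\<close> minus the projection \<open>u / 12\<close> leaves exactly the
  right-hand side minus the left-hand side.\<close>

lemma omega_form_five: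
  assumes "i \<in> S" "j \<in> S" "k \<in> S" "l \<in> S" "m \<in> S" "m \<notin> {i, j, k, l}"
  shows "omega_form S f i j k l \<le> omega_form S f i j k m + omega_form S f i j l m
      + omega_form S f i k l m + omega_form S f j k l m"
proof (cases "distinct [i, j, k, l]")
  case False
  then have "omega_form S f i j k l = 0" by (simp only: omega_form_def if_False)
  then show ?thesis using assms by (simp add: omega_form_nonneg)
next
  case True
  define In where "In f g = (\<Sum>\<pi> | \<pi> permutes S. f \<pi> * (g \<pi> :: real))" for f g :: "('a \<Rightarrow> 'a) \<Rightarrow> real"
  define C where "C f \<pi> = omega_op i j k m f \<pi> + omega_op i j l m f \<pi> + omega_op i k l m f \<pi>
      + omega_op j k l m f \<pi>" for f :: "('a \<Rightarrow> 'a) \<Rightarrow> real" and \<pi>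
  define u where "u = omega_op i j k l f"
  define g where "g = (\<lambda>\<pi>. f \<pi> + (-1/12) * u \<pi>)"
  have In_comm: "In u f = In f u" by (simp add: In_def mult.commute)
  have InC: "In f (C f) = omega_form S f i j k m + omega_form S f i j l m + omega_form S f i k l m
      + omega_form S f j k l m" for f
    using True assms by (auto simp: In_def C_def omega_form_def sum.distrib distrib_left)
  have Cadj: "In f (C h) = In (C f) h" for f h
    using True assms by (auto simp: In_def C_def sum.distrib distrib_left distrib_right omega_op_adj)
  have Clin: "C (\<lambda>\<pi>. f \<pi> + c * h \<pi>) \<pi> = C f \<pi> + c * C h \<pi>" for f c h \<pi>
    by (simp add: C_def omega_op_lin algebra_simps)
  have Cu: "C u = (\<lambda>\<pi>. 12 * u \<pi>)"
    unfolding C_def u_def using True assms(6) by (intro ext omega_op_five) auto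
  have uu: "In u u = 12 * In f u"
    using omega_op_adj[OF True assms(1-4), of f u] omega_op_omega_op[OF True, of f]
    by (simp add: In_def u_def sum_distrib_left algebra_simps)
  have lin: "In (\<lambda>\<pi>. f \<pi> + c * h \<pi>) v = In f v + c * In h v" "In v (\<lambda>\<pi>. f \<pi> + c * h \<pi>) = In v f
      + c * In v h"
    "In v (\<lambda>\<pi>. c * h \<pi>) = c * In v h" "In (\<lambda>\<pi>. c * h \<pi>) v = c * In h v" for f h v c
    by (simp_all add: In_def algebra_simps sum.distrib sum_distrib_left)
  have "0 \<le> In g (C g)" unfolding InC using assms by (simp add: omega_form_nonneg)
  also have "C g = (\<lambda>\<pi>. C f \<pi> + (-1/12) * C u \<pi>)" unfolding g_def by (intro ext Clin)
  also have "In g \<dots> = In f (C f) - In f u"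
    unfolding g_def lin Cu using Cadj[of u f] Cu uu In_comm by (simp add: lin)
  finally show ?thesis
    using True by (simp add: InC) (simp add: omega_form_def In_def u_def)
qed

section \<open>Fourfold weighted sums and their symmetries\<close>

definition sum4 :: "'a set \<Rightarrow> ('a \<Rightarrow> real) \<Rightarrow> ('a \<Rightarrow> 'a \<Rightarrow> 'a \<Rightarrow> 'a \<Rightarrow> real) \<Rightarrow> real" where
  "sum4 S e g = (\<Sum>i\<in>S. \<Sum>j\<in>S. \<Sum>k\<in>S. \<Sum>l\<in>S. e i * e j * e k * e l * g i j k l)"

lemma sum4_swap:
  "sum4 S e (\<lambda>i j k l. g j i k l) = sum4 S e g"
  "sum4 S e (\<lambda>i j k l. g i k j l) = sum4 S e g"
  "sum4 S e (\<lambda>i j k l. g i j l k) = sum4 S e g"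
proof -
  show "sum4 S e (\<lambda>i j k l. g j i k l) = sum4 S e g"
    unfolding sum4_def by (subst sum.swap) (simp add: mult.commute mult.left_commute)
  show "sum4 S e (\<lambda>i j k l. g i k j l) = sum4 S e g"
    unfolding sum4_def
    by (rule sum.cong[OF refl], subst sum.swap) (simp add: mult.commute mult.left_commute)
  show "sum4 S e (\<lambda>i j k l. g i j l k) = sum4 S e g"
    unfolding sum4_def
    by (rule sum.cong[OF refl], rule sum.cong[OF refl], subst sum.swap) (simp add: mult.commute mult.left_commute)
qed

lemma sum4_linear:
  "sum4 S e (\<lambda>i j k l. g i j k l + h i j k l) = sum4 S e g + sum4 S e h"
  "sum4 S e (\<lambda>i j k l. g i j k l - h i j k l) = sum4 S e g - sum4 S e h"
  "sum4 S e (\<lambda>i j k l. c * g i j k l) = c * sum4 S e g"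
  unfolding sum4_def
  by (simp_all add: distrib_left right_diff_distrib sum.distrib sum_subtractf sum_distrib_left mult.left_commute[of c])

lemma sum4_cong:
  assumes "\<And>i j k l. \<lbrakk>i \<in> S; j \<in> S; k \<in> S; l \<in> S\<rbrakk> \<Longrightarrow> g i j k l = h i j k l"
  shows "sum4 S e g = sum4 S e h"
  unfolding sum4_def using assms by simp

lemma sum4_mono:
  assumes "\<And>i j k l. \<lbrakk>i \<in> S; j \<in> S; k \<in> S; l \<in> S\<rbrakk> \<Longrightarrow> g i j k l \<le> h i j k l" "\<And>i. i \<in> S \<Longrightarrow> 0 \<le> e i"
  shows "sum4 S e g \<le> sum4 S e h"
  unfolding sum4_def using assms by (intro sum_mono mult_left_mono) auto

lemma sum4_const_last:
  "sum4 S e (\<lambda>i j k l. g i j k) = (\<Sum>i\<in>S. \<Sum>j\<in>S. \<Sum>k\<in>S. e i * e j * e k * g i j k) * sum e S"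
  unfolding sum4_def sum_distrib_right
  by (intro sum.cong refl) (simp add: sum_distrib_left sum_distrib_right mult.assoc mult.commute mult.left_commute)

text \<open>Each summand is independent of one index, whose summation produces the factor
  \<open>sum e S\<close>.\<close>

lemma sum4_three_zero:
  assumes "sum e S = 0"
  shows "sum4 S e (\<lambda>i j k l. g i j k + g i j l + g i k l + g j k l) = 0"
proof -
  have "sum4 S e (\<lambda>i j k l. g i j k) = 0"
    using assms by (simp add: sum4_const_last)
  moreover have "sum4 S e (\<lambda>i j k l. g i j l) = sum4 S e (\<lambda>i j k l. g i j k)"
    by (rule sum4_swap(3))
  moreover have "sum4 S e (\<lambda>i j k l. g i k l) = sum4 S e (\<lambda>i j k l. g i j l)"
    by (rule sum4_swap(2))
  moreover have "sum4 S e (\<lambda>i j k l. g j k l) = sum4 S e (\<lambda>i j k l. g i k l)"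
    by (rule sum4_swap(1))
  ultimately show ?thesis by (simp add: sum4_linear)
qed

lemma sum4_pairs:
  assumes "finite S" "\<And>i j. g i j = g j i"
  shows "sum4 S e (\<lambda>i j k l. (if i = j then g k l else 0) + (if i = k then g j l else 0) + (if i
      = l then g j k else 0)
     + (if j = k then g i l else 0) + (if j = l then g i k else 0) + (if k = l then g i j else 0))
    = 6 * ((\<Sum>i\<in>S. (e i)\<^sup>2) * (\<Sum>k\<in>S. \<Sum>l\<in>S. e k * e l * g k l))"
proof -
  let ?h = "\<lambda>i j k l. if i = j then g k l else (0::real)"
  have "sum4 S e ?h = (\<Sum>i\<in>S. \<Sum>j\<in>S. if i = j then (e i)\<^sup>2 * (\<Sum>k\<in>S. \<Sum>l\<in>S. e k * e l * g k l) else 0)"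
    unfolding sum4_def
  proof (intro sum.cong[OF refl])
    fix i j
    show "(\<Sum>k\<in>S. \<Sum>l\<in>S. e i * e j * e k * e l * ?h i j k l)
        = (if i = j then (e i)\<^sup>2 * (\<Sum>k\<in>S. \<Sum>l\<in>S. e k * e l * g k l) else 0)"
      by (cases "i = j") (simp_all add: sum_distrib_left power2_eq_square mult.assoc)
  qed
  then have 1: "sum4 S e ?h = (\<Sum>i\<in>S. (e i)\<^sup>2) * (\<Sum>k\<in>S. \<Sum>l\<in>S. e k * e l * g k l)"
    using \<open>finite S\<close> by (simp only: sum.delta' if_True sum_distrib_right cong: sum.cong_simp) simp
  have 2: "sum4 S e (\<lambda>i j k l. if i = k then g j l else 0) = sum4 S e ?h"
    by (rule sum4_swap(2)[where g = ?h])
  have 3: "sum4 S e (\<lambda>i j k l. if i = l then g j k else 0) = sum4 S e (\<lambda>i j k l. if i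
      = k then g j l else 0)"
    by (rule sum4_swap(3)[where g = "\<lambda>i j k l. if i = k then g j l else 0"])
  have 4: "sum4 S e (\<lambda>i j k l. if j = k then g i l else 0) = sum4 S e (\<lambda>i j k l. if i
      = k then g j l else 0)"
    by (rule sum4_swap(1)[where g = "\<lambda>i j k l. if i = k then g j l else 0"])
  have 5: "sum4 S e (\<lambda>i j k l. if j = l then g i k else 0) = sum4 S e (\<lambda>i j k l. if j
      = k then g i l else 0)"
    by (rule sum4_swap(3)[where g = "\<lambda>i j k l. if j = k then g i l else 0"])
  have 6: "sum4 S e (\<lambda>i j k l. if k = l then g i j else 0) = sum4 S e (\<lambda>i j k l. if j
      = l then g i k else 0)"
    by (rule sum4_swap(2)[where g = "\<lambda>i j k l. if j = l then g i k else 0"])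
  show ?thesis by (simp only: sum4_linear 1 2 3 4 5 6)
qed

text \<open>Since \<open>g\<close> vanishes as soon as \<open>n\<close> occurs twice, only terms
  with at most one \<open>n\<close> survive. The four positions of \<open>n\<close> give equal sums,
  and the factor \<open>e n = - sum e S\<close> is absorbed by summing over a free fourth
  index.\<close>

lemma sum4_insert:
  assumes "finite S" "n \<notin> S" "sum e (insert n S) = 0"
    and sym: "\<And>i j k l. g j i k l = g i j k l" "\<And>i j k l. g i k j l = g i j k l"
        "\<And>i j k l. g i j l k = g i j k l"
    and diag: "\<And>i j. g n n i j = 0"
  shows "sum4 (insert n S) e g = sum4 S e (\<lambda>i j k l. g i j k l - (g i j k n + g i j l n
      + g i k l n + g j k l n))"
proof -
  have en: "e n = - sum e S" using assms by simp
  have n1: "g i j k n = g n i j k" for i j k by (metis sym)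
  have z: "g n n i j = 0" "g n i n j = 0" "g n i j n = 0" "g i n n j = 0" "g i n j n = 0"
      "g i j n n = 0" for i j
    by (metis sym diag)+
  have s: "g i n j k = g n i j k" "g i j n k = g n i j k" "g i j k n = g n i j k" for i j k
      by (metis sym)+
  have 1: "sum4 (insert n S) e g = sum4 S e g + 4 * e n * (\<Sum>i\<in>S. \<Sum>j\<in>S. \<Sum>k\<in>S. e i * e j * e k
      * g n i j k)"
  proof -
    define T where "T h = (\<Sum>i\<in>S. e i * h i)" for h
    have V: "(\<Sum>i\<in>insert n S. e i * h i) = e n * h n + T h" for h
      using assms(1,2) by (simp add: T_def)
    have T: "T (\<lambda>i. h i + h' i) = T h + T h'" "T (\<lambda>i. c * h i) = c * T h" "T (\<lambda>i. 0) = 0" for h h' c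
      by (simp_all add: T_def distrib_left sum.distrib sum_distrib_left mult.left_commute)
    have nested: "sum4 U e g = (\<Sum>i\<in>U. e i * (\<Sum>j\<in>U. e j * (\<Sum>k\<in>U. e k * (\<Sum>l\<in>U. e l * g i j k l))))"
        for U
      by (simp add: sum4_def sum_distrib_left mult.assoc)
    have nested3: "(\<Sum>i\<in>S. \<Sum>j\<in>S. \<Sum>k\<in>S. e i * e j * e k * g n i j k)
        = T (\<lambda>i. T (\<lambda>j. T (\<lambda>k. g n i j k)))"
      by (simp add: T_def sum_distrib_left mult.assoc)
    show ?thesis
      unfolding nested nested3 V z unfolding T_def[symmetric] s by (simp add: T)
  qed
  have "sum4 S e (\<lambda>i j k l. g n i j k) = (\<Sum>i\<in>S. \<Sum>j\<in>S. \<Sum>k\<in>S. e i * e j * e k * g n i j k) * sum e S"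
    by (rule sum4_const_last)
  moreover have "sum4 S e (\<lambda>i j k l. g n i j l) = sum4 S e (\<lambda>i j k l. g n i j k)"
    by (rule sum4_swap(3))
  moreover have "sum4 S e (\<lambda>i j k l. g n i k l) = sum4 S e (\<lambda>i j k l. g n i j l)"
    by (rule sum4_swap(2))
  moreover have "sum4 S e (\<lambda>i j k l. g n j k l) = sum4 S e (\<lambda>i j k l. g n i k l)"
    by (rule sum4_swap(1))
  ultimately show ?thesis by (simp add: 1 sum4_linear n1 en)
qed

text \<open>
  The values of \<open>X\<close> at coinciding arguments are chosen so that the identity also holds when indices
  coincide; every \<open>X\<close>-term is independent of one index and drops out after summation against weights
  of total mass zero.
\<close>

lemma omega_form_expand:
  fixes f :: "('a \<Rightarrow> 'a) \<Rightarrow> real"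
  assumes "i \<in> S" "j \<in> S" "k \<in> S" "l \<in> S"
  defines "c2 \<equiv> \<lambda>i j k l. \<Sum>\<pi> | \<pi> permutes S. f \<pi> * f (\<pi> \<circ> tr i j \<circ> tr k l)"
  defines "c1 \<equiv> \<lambda>i j. \<Sum>\<pi> | \<pi> permutes S. f \<pi> * f (\<pi> \<circ> tr i j)"
  defines "c0 \<equiv> \<Sum>\<pi> | \<pi> permutes S. f \<pi> * f \<pi>"
  defines "X \<equiv> \<lambda>i j k. if distinct [i, j, k] then c0 / 2 - 2 * c2 i j j k
    else if i = j \<and> j = k then 3 / 2 * c0 else - c0 / 2"
  shows "omega_form S f i j k l = 2 * (c2 i j k l + c2 i k j l + c2 i l j k)
    + (X i j k + X i j l + X i k l + X j k l)
    - 2 * ((if i = j then c1 k l else 0) + (if i = k then c1 j l else 0) + (if i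
        = l then c1 j k else 0)
     + (if j = k then c1 i l else 0) + (if j = l then c1 i k else 0) + (if k
         = l then c1 i j else 0))"
    (is "_ = ?R i j k l")
proof -
  have c1s: "c1 j i = c1 i j" for i j by (simp add: c1_def transpose_commute)
  have c10: "c1 i i = c0" for i by (simp add: c1_def c0_def)
  have c2s: "c2 j i k l = c2 i j k l" "c2 i j l k = c2 i j k l" for i j k l
    by (simp_all add: c2_def transpose_commute)
  have c20: "c2 i i k l = c1 k l" "c2 k l i i = c1 k l" "c2 i j i j = c0" "c2 i j j i = c0"
      for i j k l
    by (simp_all add: c2_def c1_def c0_def comp_assoc transpose_commute[of j i])
  have c2a: "c2 k l i j = c2 i j k l" if "i \<in> S" "j \<in> S" "k \<in> S" "l \<in> S" for i j k l
    unfolding c2_def using sum_perm_adj2[of i S j k l f f] that by (simp add: mult.commute)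
  \<comment> \<open>A three-cycle has three factorisations into two transpositions, and
    \<open>c2a\<close> identifies it with its inverse; so the values in \<open>c3\<close> depend
    only on the set of the three indices.\<close>
  have cyc: "c2 j k k i = c2 i j j k" if "distinct [i, j, k]" for i j k
  proof -
    have "\<pi> \<circ> tr j k \<circ> tr k i = \<pi> \<circ> tr i j \<circ> tr j k" for \<pi> :: "'a \<Rightarrow> 'a"
      using that by (auto simp: fun_eq_iff Transposition.transpose_def)
    then show ?thesis by (simp add: c2_def)
  qed
  have c3: "c2 j i i k = c2 i j j k" "c2 i k k j = c2 i j j k" "c2 i j i k = c2 i j j k"
    if "distinct [i, j, k]" "i \<in> S" "j \<in> S" "k \<in> S" for i j k
  proof -
    show 1: "c2 j i i k = c2 i j j k"
      using cyc[of k i j] cyc[of i j k] that c2a[of j i i k] by (simp add: c2s) (metis c2s)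
    then show "c2 i j i k = c2 i j j k" by (simp add: c2s)
    show "c2 i k k j = c2 i j j k"
      using cyc[of i j k] c2a[of j k k i] that by (simp add: c2s)
  qed
  have X: "X j i k = X i j k" "X i k j = X i j k" if "i \<in> S" "j \<in> S" "k \<in> S" for i j k
    using c3[of i j k] that by (auto simp: X_def)
  \<comment> \<open>The right-hand side is invariant under exchanges of adjacent indices, so any
    coincidence of two indices can be moved to the first two places, where \<open>R0\<close> gives
    zero.\<close>
  have Rs: "?R j i k l = ?R i j k l" "?R i k j l = ?R i j k l" "?R i j l k = ?R i j k l"
    if "i \<in> S" "j \<in> S" "k \<in> S" "l \<in> S" for i j k l
  proof -
    have "c2 j k i l = c2 i l j k" "c2 j l i k = c2 i k j l" using c2a that by auto
    then show "?R j i k l = ?R i j k l"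
      using X that c2s c1s by simp
    have "c2 k j i l = c2 i l j k" using c2a that c2s by metis
    then show "?R i k j l = ?R i j k l"
      using X that c2s c1s by simp
    have "c2 i l k j = c2 i l j k" using c2s by metis
    then show "?R i j l k = ?R i j k l"
      using X that c2s c1s by simp
  qed
  have R0: "?R i i k l = 0" if "i \<in> S" "k \<in> S" "l \<in> S" for i k l
  proof -
    have "c2 i l i k = c2 i k i l" using c2a that by auto
    then show ?thesis
      using that c3[of i k l] by (auto simp: X_def c20 c10 c1s c2s)
  qed
  show ?thesis
  proof (cases "distinct [i, j, k, l]")
    case True
    have "omega_form S f i j k l = 2 * c0 + 2 * (c2 i j k l + c2 i k j l + c2 i l j k)
        - (c2 i j j k + c2 j k i j + c2 i j j l + c2 j l i j + c2 i k k l + c2 k l i k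
            + c2 j k k l + c2 k l j k)"
      using True unfolding omega_form_def omega_op_word[OF True]
      by (simp add: distrib_left distrib_right left_diff_distrib right_diff_distrib mult.left_commute[of _ 2] mult.assoc
        sum.distrib sum_subtractf sum_distrib_left[symmetric] c2_def c0_def)
    also have "\<dots> = ?R i j k l"
      using True assms(1-4) c2a[of i j j k] c2a[of i j j l] c2a[of i k k l] c2a[of j k k l]
      by (simp add: X_def)
    finally show ?thesis .
  next
    case False
    then have "i = j \<or> i = k \<or> i = l \<or> j = k \<or> j = l \<or> k = l" by auto
    moreover define R where "R = ?R"
    have "R j i k l = R i j k l" "R i k j l = R i j k l" "R i j l k = R i j k l" "R i i k l = 0"
      if "i \<in> S" "j \<in> S" "k \<in> S" "l \<in> S" for i j k l
      unfolding R_def by (intro Rs R0 that)+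
    ultimately have "R i j k l = 0"
      using assms(1-4) by metis
    then show ?thesis using False by (simp only: omega_form_def if_False R_def)
  qed
qed

section \<open>Energies of transpositions and the octopus inequality\<close>

definition swap_energy where
  "swap_energy S f i j = (\<Sum>\<pi> | \<pi> permutes S. (f (\<pi> \<circ> tr i j) - f \<pi> :: real)\<^sup>2)"

text \<open>Giving \<open>n\<close> the weight \<open>- sum a S\<close> makes the total weight zero,
  and the left-hand side minus the right-hand side becomes \<open>- 2 * Q\<close>, with
  \<open>Q\<close> the quadratic form of M. The weighted sum of \<open>omega_form\<close> equals six
  times the squared norm of M applied to \<open>f\<close>, minus \<open>12 * Q\<close> times the sum
  of the squared weights; it is nonpositive, which forces \<open>Q\<close> to be
  nonnegative.\<close>

lemma octopus:
  fixes f :: "('a \<Rightarrow> 'a) \<Rightarrow> real"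
  assumes "finite S" "n \<notin> S" and a: "\<And>i. i \<in> S \<Longrightarrow> a i \<ge> 0"
  shows "(\<Sum>i\<in>S. \<Sum>j\<in>S. a i * a j * swap_energy (insert n S) f i j) \<le> 2 * sum a S * (\<Sum>i\<in>S. a i
      * swap_energy (insert n S) f i n)"
proof -
  define V where "V = insert n S"
  have V: "finite V" using assms by (simp add: V_def)
  define c2 where "c2 = (\<lambda>i j k l. \<Sum>\<pi> | \<pi> permutes V. f \<pi> * f (\<pi> \<circ> tr i j \<circ> tr k l))"
  define c1 where "c1 = (\<lambda>i j. \<Sum>\<pi> | \<pi> permutes V. f \<pi> * f (\<pi> \<circ> tr i j))"
  define c0 where "c0 = (\<Sum>\<pi> | \<pi> permutes V. f \<pi> * f \<pi>)"
  define X where "X = (\<lambda>i j k. if distinct [i, j, k] then c0 / 2 - 2 * c2 i j j k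
    else if i = j \<and> j = k then 3 / 2 * c0 else - c0 / 2)"
  define e where "e = a(n := - sum a S)"
  have ea: "i \<in> S \<Longrightarrow> e i = a i" and en: "e n = - sum a S" for i using assms by (auto simp: e_def)
  have e0: "sum e V = 0" using assms ea by (simp add: V_def en)
  define Q where "Q = (\<Sum>i\<in>V. \<Sum>j\<in>V. e i * e j * c1 i j)"
  have c1s: "c1 i j = c1 j i" for i j by (simp add: c1_def transpose_commute)
  have "sum4 V e (omega_form V f) = sum4 V e (\<lambda>i j k l. 2 * (c2 i j k l + c2 i k j l + c2 i l j k)
    + (X i j k + X i j l + X i k l + X j k l)
    - 2 * ((if i = j then c1 k l else 0) + (if i = k then c1 j l else 0) + (if i
        = l then c1 j k else 0)
     + (if j = k then c1 i l else 0) + (if j = l then c1 i k else 0) + (if k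
         = l then c1 i j else 0)))"
    unfolding c0_def c1_def c2_def X_def by (intro sum4_cong omega_form_expand)
  also have "\<dots> = 2 * (sum4 V e c2 + sum4 V e (\<lambda>i j k l. c2 i k j l)
      + sum4 V e (\<lambda>i j k l. c2 i l j k))
      - 12 * ((\<Sum>i\<in>V. (e i)\<^sup>2) * Q)"
    unfolding sum4_linear(2)[where h = "\<lambda>i j k l. 2 * _ i j k l"] sum4_linear(3)[where c
        = 2] sum4_pairs[of V c1 e, OF V c1s]
      sum4_linear(1)[where h = "\<lambda>i j k l. X i j k + X i j l + X i k l
          + X j k l"] sum4_three_zero[OF e0] Q_def
    by (simp add: sum4_linear)
  also have "sum4 V e (\<lambda>i j k l. c2 i k j l) = sum4 V e c2" by (rule sum4_swap(2))
  also have "sum4 V e (\<lambda>i j k l. c2 i l j k) = sum4 V e (\<lambda>i j k l. c2 i k j l)"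
    by (rule sum4_swap(3)[where g = "\<lambda>i j k l. c2 i k j l"])
  also have "sum4 V e (\<lambda>i j k l. c2 i k j l) = sum4 V e c2" by (rule sum4_swap(2))
  finally have eq: "sum4 V e (omega_form V f) = 6 * sum4 V e c2 - 12 * ((\<Sum>i\<in>V. (e i)\<^sup>2) * Q)"
      by simp
  \<comment> \<open>Transpositions are self-adjoint, so the coefficients \<open>c2\<close> assemble
    to the squared norm of M applied to \<open>f\<close>.\<close>
  have "sum4 V e c2 = (\<Sum>\<pi> | \<pi> permutes V. (\<Sum>i\<in>V. \<Sum>j\<in>V. e i * e j * f (\<pi> \<circ> tr i j))\<^sup>2)"
  proof -
    have c2: "c2 i j k l = (\<Sum>\<pi> | \<pi> permutes V. f (\<pi> \<circ> tr i j) * f (\<pi> \<circ> tr k l))" if "i \<in> V"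
        "j \<in> V" for i j k l
      unfolding c2_def using sum_perm_adj[OF that, of f "\<lambda>\<pi>. f (\<pi> \<circ> tr k l)"] by simp
    have "sum4 V e c2 = (\<Sum>\<pi> | \<pi> permutes V. \<Sum>i\<in>V. \<Sum>j\<in>V. \<Sum>k\<in>V. \<Sum>l\<in>V.
        (e i * e j * f (\<pi> \<circ> tr i j)) * (e k * e l * f (\<pi> \<circ> tr k l)))"
      by (simp add: sum4_def c2 sum_distrib_left sum.swap[of _ V
          "{\<pi>. \<pi> permutes V}"] mult.assoc mult.left_commute)
    also have "\<dots> = (\<Sum>\<pi> | \<pi> permutes V. (\<Sum>i\<in>V. \<Sum>j\<in>V. e i * e j * f (\<pi> \<circ> tr i j))\<^sup>2)"
      unfolding power2_eq_square by (simp only: sum_distrib_right, simp only: sum_distrib_left)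
    finally show ?thesis .
  qed
  then have "sum4 V e c2 \<ge> 0" by (simp add: sum_nonneg)
  \<comment> \<open>Eliminating the negative weight leaves nonnegative weights on \<open>S\<close>,
    and each bracket is nonpositive by \<open>omega_form_five\<close>.\<close>
  moreover have "sum4 V e (omega_form V f) \<le> 0"
  proof -
    have "sum4 V e (omega_form V f) = sum4 S e (\<lambda>i j k l. omega_form V f i j k l
        - (omega_form V f i j k n + omega_form V f i j l n + omega_form V f i k l n
            + omega_form V f j k l n))"
      unfolding V_def using assms(1,2) e0
      by (intro sum4_insert) (auto simp: omega_form_swap V_def, simp add: omega_form_def)
    also have "\<dots> \<le> sum4 S e (\<lambda>i j k l. 0)"
      using assms by (intro sum4_mono) (auto simp: ea V_def intro!: omega_form_five)
    finally show ?thesis by (simp add: sum4_def)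
  qed
  ultimately have SQ: "(\<Sum>i\<in>V. (e i)\<^sup>2) * Q \<ge> 0" using eq by linarith
  have "Q \<ge> 0"
  proof (cases "(\<Sum>i\<in>V. (e i)\<^sup>2) = 0")
    case True
    then have "\<forall>i\<in>V. e i = 0" using V by (simp add: sum_nonneg_eq_0_iff)
    then show ?thesis by (simp add: Q_def)
  next
    case False
    then have "(\<Sum>i\<in>V. (e i)\<^sup>2) > 0" by (simp add: sum_nonneg less_le)
    then show ?thesis using SQ by (simp add: zero_le_mult_iff)
  qed
  \<comment> \<open>The part \<open>2 * c0\<close> is the same for all pairs and cancels, because
    the weights sum to zero.\<close>
  have D: "swap_energy V f i j = 2 * c0 - 2 * c1 i j" if "i \<in> V" "j \<in> V" for i j
    using sum_perm_tr[OF that, of "\<lambda>\<pi>. f \<pi> * f \<pi>"]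
    by (simp add: swap_energy_def c0_def c1_def power2_eq_square algebra_simps sum.distrib sum_subtractf sum_distrib_left)
  have "(\<Sum>i\<in>V. \<Sum>j\<in>V. e i * e j * swap_energy V f i j) = (\<Sum>i\<in>V. \<Sum>j\<in>V. 2 * c0 * (e i * e j) - 2
      * (e i * e j * c1 i j))"
    by (intro sum.cong refl) (simp add: D algebra_simps)
  also have "\<dots> = 2 * c0 * (sum e V * sum e V) - 2 * Q"
    by (simp add: sum_subtractf sum_distrib_left[symmetric] Q_def sum_product)
  finally have "(\<Sum>i\<in>V. \<Sum>j\<in>V. e i * e j * swap_energy V f i j) \<le> 0"
    using e0 \<open>Q \<ge> 0\<close> by simp
  moreover have "(\<Sum>i\<in>V. \<Sum>j\<in>V. e i * e j * swap_energy V f i j)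
     = (\<Sum>i\<in>S. \<Sum>j\<in>S. a i * a j * swap_energy V f i j) - 2 * sum a S * (\<Sum>i\<in>S. a i
         * swap_energy V f i n)"
  proof -
    have nn: "swap_energy V f n n = 0" "swap_energy V f n j = swap_energy V f j n" for j
      by (simp_all add: swap_energy_def transpose_commute)
    have "(\<Sum>i\<in>V. \<Sum>j\<in>V. e i * e j * swap_energy V f i j) =
       (\<Sum>i\<in>S. \<Sum>j\<in>S. e i * e j * swap_energy V f i j) + 2 * e n * (\<Sum>i\<in>S. e i * swap_energy V f i n)"
    proof -
      have V_sum: "(\<Sum>i\<in>V. h i) = h n + (\<Sum>i\<in>S. h i)" for h :: "'a \<Rightarrow> real"
        using assms(1,2) by (simp add: V_def)
      show ?thesis
        unfolding V_sum nn(1) unfolding nn(2)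
        by (simp add: sum.distrib sum_distrib_left mult.assoc mult.commute mult.left_commute)
    qed
    then show ?thesis by (simp add: ea en)
  qed
  ultimately show ?thesis by (simp add: V_def)
qed

section \<open>The spectral gap of the interchange process\<close>

lemma swap_energy_form:
  assumes "i \<in> S" "j \<in> S"
  shows "(\<Sum>\<pi> | \<pi> permutes S. f \<pi> * (f \<pi> - f (\<pi> \<circ> tr i j))) = swap_energy S f i j / 2"
  using sum_perm_tr[OF assms, of "\<lambda>\<pi>. f \<pi> * f \<pi>"]
  by (simp add: swap_energy_def power2_eq_square algebra_simps sum.distrib sum_subtractf sum_distrib_left)

lemma sum_tr_form:
  fixes x :: "'a \<Rightarrow> real"
  assumes "finite S" "j \<in> S" "k \<in> S"
  shows "(\<Sum>i\<in>S. x i * (x i - x (tr j k i))) = (x j - x k)\<^sup>2"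
proof -
  have "(\<Sum>i\<in>S. x i * (x i - x (tr j k i))) = (\<Sum>i\<in>{j, k}. x i * (x i - x (tr j k i)))"
    using assms by (intro sum.mono_neutral_right) (auto simp: Transposition.transpose_def)
  then show ?thesis by (cases "j = k") (auto simp: power2_eq_square algebra_simps)
qed

text \<open>Twice a variance is the mean squared difference of two independent copies, scaled here
  by the total mass. At total mass zero all weights vanish, so the division by zero is
  harmless.\<close>

lemma weighted_variance:
  fixes c y :: "'a \<Rightarrow> real"
  assumes "finite S" "\<And>i. i \<in> S \<Longrightarrow> c i \<ge> 0"
  shows "2 * (\<Sum>i\<in>S. c i * (y i - (\<Sum>i\<in>S. c i * y i) / sum c S)\<^sup>2)
    = (\<Sum>i\<in>S. \<Sum>j\<in>S. c i * c j / sum c S * (y i - y j)\<^sup>2)"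
proof (cases "sum c S = 0")
  case True
  then have "\<forall>i\<in>S. c i = 0" using assms by (simp add: sum_nonneg_eq_0_iff)
  then show ?thesis by simp
next
  case False
  define s where "s = sum c S"
  define A where "A = (\<Sum>i\<in>S. c i * y i)"
  define B where "B = (\<Sum>i\<in>S. c i * (y i)\<^sup>2)"
  have s: "s \<noteq> 0" using False by (simp add: s_def)
  have "(\<Sum>i\<in>S. c i * (y i - A / s)\<^sup>2) = (\<Sum>i\<in>S. c i * (y i)\<^sup>2 - 2 * (A / s) * (c i * y i)
      + (A / s)\<^sup>2 * c i)"
    by (intro sum.cong refl) (simp add: power2_eq_square algebra_simps)
  also have "\<dots> = B - 2 * (A / s) * A + (A / s)\<^sup>2 * s"
    by (simp only: sum.distrib sum_subtractf sum_distrib_left[symmetric] A_def B_def s_def)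
  also have "\<dots> = B - A\<^sup>2 / s" using s by (simp add: field_simps power2_eq_square)
  finally have 1: "(\<Sum>i\<in>S. c i * (y i - A / s)\<^sup>2) = B - A\<^sup>2 / s" .
  have "(\<Sum>i\<in>S. \<Sum>j\<in>S. c i * c j / s * (y i - y j)\<^sup>2)
     = (\<Sum>i\<in>S. \<Sum>j\<in>S. 1 / s * (c i * (y i)\<^sup>2 * c j) - 2 / s * (c i * y i * (c j * y j)) + 1 / s
         * (c i * (c j * (y j)\<^sup>2)))"
    by (intro sum.cong refl) (use s in \<open>simp add: power2_eq_square field_simps\<close>)
  also have "\<dots> = 1 / s * (B * s) - 2 / s * (A * A) + 1 / s * (s * B)"
    by (simp only: sum.distrib sum_subtractf sum_distrib_left[symmetric] sum_distrib_right[symmetric] A_def B_def s_def)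
  also have "\<dots> = 2 * (B - A\<^sup>2 / s)" using s by (simp add: field_simps power2_eq_square)
  finally show ?thesis using 1 by (simp add: s_def A_def)
qed

text \<open>The new weights describe the electrical network with \<open>n\<close> eliminated: the
  energy of \<open>y\<close> there equals the energy of its harmonic extension to \<open>n\<close>,
  to which the gap hypothesis on the larger set applies.\<close>

lemma reduced_gap:
  fixes b :: "'a \<Rightarrow> 'a \<Rightarrow> real"
  assumes "finite S" "n \<notin> S"
    and sym: "\<And>i j. b i j = b j i"
    and nn: "\<And>i j. i \<in> insert n S \<Longrightarrow> j \<in> insert n S \<Longrightarrow> b i j \<ge> 0"
    and rw: "\<And>x. sum x (insert n S) = 0 \<Longrightarrow>
      lam * (\<Sum>i\<in>insert n S. (x i)\<^sup>2) \<le> (\<Sum>i\<in>insert n S. \<Sum>j\<in>insert n S. b i j * (x i - x j)\<^sup>2)"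
    and y0: "sum y S = 0"
  shows "lam * (\<Sum>i\<in>S. (y i)\<^sup>2) \<le> (\<Sum>i\<in>S. \<Sum>j\<in>S. (b i j + b n i * b n j / sum (b n) S) * (y i
      - y j)\<^sup>2)" (is "_ \<le> ?R")
proof (cases "lam \<ge> 0")
  case False
  have "?R \<ge> 0" using nn
      by (intro sum_nonneg mult_nonneg_nonneg add_nonneg_nonneg divide_nonneg_nonneg) auto
  moreover have "lam * (\<Sum>i\<in>S. (y i)\<^sup>2) \<le> 0" using False
      by (intro mult_nonpos_nonneg sum_nonneg) auto
  ultimately show ?thesis by linarith
next
  case True
  define V where "V = insert n S"
  define h where "h = (\<Sum>i\<in>S. b n i * y i) / sum (b n) S"
  define x where "x = y(n := h)" \<comment> \<open>the extension of \<open>y\<close> that is harmonic at \<open>n\<close>\<close>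
  \<comment> \<open>The gap hypothesis needs mean zero on the larger set. Recentring cannot decrease
    the squared norm on \<open>S\<close>, because \<open>y\<close> has mean zero there.\<close>
  define m where "m = sum x V / card V"
  have V: "finite V" "card V > 0" and xS: "\<And>i. i \<in> S \<Longrightarrow> x i = y i" and xn: "x n = h"
    using assms by (auto simp: V_def x_def card_gt_0_iff)
  have V_sum: "(\<Sum>i\<in>V. g i) = g n + (\<Sum>i\<in>S. g i)" for g :: "'a \<Rightarrow> real"
    using assms(1,2) by (simp add: V_def)
  have "(\<Sum>i\<in>S. (y i)\<^sup>2) \<le> (\<Sum>i\<in>S. (y i)\<^sup>2) + card S * m\<^sup>2" by simp
  also have "\<dots> = (\<Sum>i\<in>S. (y i)\<^sup>2) - 2 * m * sum y S + card S * m\<^sup>2" using y0 by simp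
  also have "\<dots> = (\<Sum>i\<in>S. (x i - m)\<^sup>2)"
  proof -
    have "(\<Sum>i\<in>S. (x i - m)\<^sup>2) = (\<Sum>i\<in>S. (y i)\<^sup>2 - 2 * m * y i + m\<^sup>2)"
      by (intro sum.cong refl) (simp add: xS power2_eq_square algebra_simps)
    then show ?thesis by (simp add: sum.distrib sum_subtractf sum_distrib_left)
  qed
  also have "\<dots> \<le> (\<Sum>i\<in>V. (x i - m)\<^sup>2)" by (simp add: V_sum)
  finally have "lam * (\<Sum>i\<in>S. (y i)\<^sup>2) \<le> lam * (\<Sum>i\<in>V. (x i - m)\<^sup>2)"
    using True by (rule mult_left_mono)
  also have "\<dots> \<le> (\<Sum>i\<in>V. \<Sum>j\<in>V. b i j * (x i - x j)\<^sup>2)"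
    using rw[of "\<lambda>i. x i - m"] V by (simp add: V_def[symmetric] sum_subtractf m_def)
  also have "\<dots> = (\<Sum>i\<in>S. \<Sum>j\<in>S. b i j * (y i - y j)\<^sup>2) + 2 * (\<Sum>i\<in>S. b n i * (y i - h)\<^sup>2)"
  proof -
    have "(\<Sum>j\<in>S. b n j * (x n - x j)\<^sup>2) = (\<Sum>i\<in>S. b n i * (y i - h)\<^sup>2)"
      "(\<Sum>i\<in>S. b i n * (x i - x n)\<^sup>2) = (\<Sum>i\<in>S. b n i * (y i - h)\<^sup>2)"
      "(\<Sum>i\<in>S. \<Sum>j\<in>S. b i j * (x i - x j)\<^sup>2) = (\<Sum>i\<in>S. \<Sum>j\<in>S. b i j * (y i - y j)\<^sup>2)"
      by (intro sum.cong refl; simp add: xn xS power2_commute sym)+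
    then show ?thesis by (simp add: V_sum sum.distrib)
  qed
  also have "2 * (\<Sum>i\<in>S. b n i * (y i - h)\<^sup>2) = (\<Sum>i\<in>S. \<Sum>j\<in>S. b n i * b n j / sum (b n) S * (y i
      - y j)\<^sup>2)"
    unfolding h_def using assms by (intro weighted_variance) auto
  finally show ?thesis by (simp add: distrib_right sum.distrib)
qed

text \<open>
  Aldous' conjecture (Caputo, Liggett, Richthammer).  The factor 2 comes from comparing a sum of
  squared differences over all permutations, where a transposition moves both endpoints of an edge.
\<close>

theorem interchange_gap:
  fixes S :: "'a set" and b :: "'a \<Rightarrow> 'a \<Rightarrow> real"
  assumes "finite S"
    and sym: "\<And>i j. b i j = b j i"
    and nn: "\<And>i j. i \<in> S \<Longrightarrow> j \<in> S \<Longrightarrow> b i j \<ge> 0"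
    and rw: "\<And>x. sum x S = 0 \<Longrightarrow> lam * (\<Sum>i\<in>S. (x i)\<^sup>2) \<le> (\<Sum>i\<in>S. \<Sum>j\<in>S. b i j * (x i - x j)\<^sup>2)"
    and f0: "(\<Sum>\<pi> | \<pi> permutes S. f \<pi>) = 0"
  shows "2 * lam * (\<Sum>\<pi> | \<pi> permutes S. (f \<pi>)\<^sup>2) \<le> (\<Sum>i\<in>S. \<Sum>j\<in>S. b i j * swap_energy S f i j)"
  using assms
proof (induction S arbitrary: b f rule: finite_induct)
  case empty
  then show ?case by (simp add: id_def)
next
  case (insert n S)
  define V where "V = insert n S"
  have V: "finite V" using insert by (simp add: V_def)
  have nn: "b i j \<ge> 0" if "i \<in> V" "j \<in> V" for i j using insert.prems(2) that by (simp add: V_def)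
  define P where "P = {\<pi>. \<pi> permutes V}"
  have P: "finite P" using V by (simp add: P_def finite_permutations)
  define L where "L f \<pi> = (\<Sum>i\<in>V. \<Sum>j\<in>V. b i j * (f \<pi> - f (\<pi> \<circ> tr i j)))" for f ::
      "('a \<Rightarrow> 'a) \<Rightarrow> real" and \<pi>
  have swapPV: "(\<Sum>\<pi>\<in>P. \<Sum>i\<in>V. \<Sum>j\<in>V. F \<pi> i j) = (\<Sum>i\<in>V. \<Sum>j\<in>V. \<Sum>\<pi>\<in>P. F \<pi> i j)" for F ::
      "_ \<Rightarrow> _ \<Rightarrow> _ \<Rightarrow> real"
    by (simp add: sum.swap[of _ V P])
  have Lform: "(\<Sum>\<pi>\<in>P. f \<pi> * L f \<pi>) = (\<Sum>i\<in>V. \<Sum>j\<in>V. b i j * swap_energy V f i j) / 2" for f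
  proof -
    have "(\<Sum>\<pi>\<in>P. f \<pi> * L f \<pi>) = (\<Sum>i\<in>V. \<Sum>j\<in>V. \<Sum>\<pi>\<in>P. b i j * (f \<pi> * (f \<pi> - f (\<pi> \<circ> tr i j))))"
      unfolding L_def sum_distrib_left swapPV by (simp add: mult.left_commute)
    also have "\<dots> = (\<Sum>i\<in>V. \<Sum>j\<in>V. b i j * (swap_energy V f i j / 2))"
      by (intro sum.cong refl) (simp add: sum_distrib_left[symmetric] P_def swap_energy_form)
    finally show ?thesis by (simp add: sum_divide_distrib)
  qed
  show ?case
  proof (rule ccontr)
    assume neg: "\<not> ?case"
    define E where "E f = (\<Sum>i\<in>V. \<Sum>j\<in>V. b i j * swap_energy V f i j)" for f
    have neg: "E f < 2 * lam * (\<Sum>\<pi>\<in>P. (f \<pi>)\<^sup>2)"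
      using neg by (simp add: E_def V_def P_def)
    have Enn: "E f \<ge> 0" for f
      unfolding E_def swap_energy_def using nn by (intro sum_nonneg mult_nonneg_nonneg) auto
    have f0: "(\<Sum>\<pi>\<in>P. f \<pi>) = 0" using insert.prems by (simp add: P_def V_def)
    have fne: "\<exists>\<pi>\<in>P. f \<pi> \<noteq> 0"
    proof (rule ccontr)
      assume "\<not> ?thesis"
      then show False using neg Enn[of f] by simp
    qed
    \<comment> \<open>The violation by \<open>f\<close> pushes the minimal Rayleigh quotient below
      \<open>lam\<close>. Passing to the minimiser gains an eigenvalue equation, which survives
      projection to the random walk of a single particle.\<close>
    obtain \<mu> g where g: "\<exists>\<pi>\<in>P. g \<pi> \<noteq> 0" "(\<Sum>\<pi>\<in>P. g \<pi> * 1) = 0" "\<And>\<pi>. \<pi> \<in> P \<Longrightarrow> L g \<pi> = \<mu> * g \<pi>"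
      and min: "\<And>h. (\<Sum>\<pi>\<in>P. h \<pi> * 1) = 0 \<Longrightarrow> \<mu> * (\<Sum>\<pi>\<in>P. (h \<pi>)\<^sup>2) \<le> (\<Sum>\<pi>\<in>P. h \<pi> * L h \<pi>)"
    proof (rule Rayleigh_minimiser[of P L "\<lambda>_. 1" 0 f])
      show "L (\<lambda>\<pi>. x \<pi> + t * y \<pi>) \<pi> = L x \<pi> + t * L y \<pi>" for x y t \<pi>
        by (simp add: L_def algebra_simps sum.distrib sum_subtractf sum_distrib_left)
      show "continuous_on UNIV (\<lambda>x. L x \<pi>)" for \<pi>
        unfolding L_def by (intro continuous_intros continuous_on_product_coordinates)
      show "(\<Sum>\<pi>\<in>P. x \<pi> * L y \<pi>) = (\<Sum>\<pi>\<in>P. L x \<pi> * y \<pi>)" for x y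
      proof -
        have "(\<Sum>\<pi>\<in>P. x \<pi> * L y \<pi>) = (\<Sum>i\<in>V. \<Sum>j\<in>V. b i j * ((\<Sum>\<pi>\<in>P. x \<pi> * y \<pi>) - (\<Sum>\<pi>\<in>P. x \<pi>
            * y (\<pi> \<circ> tr i j))))"
          unfolding L_def sum_distrib_left swapPV sum_subtractf[symmetric]
              by (simp add: algebra_simps)
        also have "\<dots> = (\<Sum>i\<in>V. \<Sum>j\<in>V. b i j * ((\<Sum>\<pi>\<in>P. x \<pi> * y \<pi>) - (\<Sum>\<pi>\<in>P. x (\<pi> \<circ> tr i j) * y \<pi>)))"
          by (intro sum.cong refl) (simp add: P_def sum_perm_adj)
        also have "\<dots> = (\<Sum>\<pi>\<in>P. L x \<pi> * y \<pi>)"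
          unfolding L_def sum_distrib_right swapPV sum_subtractf[symmetric]
              by (simp add: algebra_simps sum_distrib_left)
        finally show ?thesis .
      qed
    qed (use P fne f0 in \<open>auto simp: L_def\<close>)
    have "(\<Sum>\<pi>\<in>P. (h \<pi>)\<^sup>2) > 0" if "\<exists>\<pi>\<in>P. h \<pi> \<noteq> 0" for h :: "_ \<Rightarrow> real"
      using that P by (metis sum_pos2 zero_le_power2 zero_less_power2)
    then have pos: "(\<Sum>\<pi>\<in>P. (f \<pi>)\<^sup>2) > 0" "(\<Sum>\<pi>\<in>P. (g \<pi>)\<^sup>2) > 0"
      using fne g(1) by auto
    have "\<mu> * (\<Sum>\<pi>\<in>P. (f \<pi>)\<^sup>2) \<le> E f / 2"
      using min[of f] f0 by (simp add: Lform E_def)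
    also have "\<dots> < lam * (\<Sum>\<pi>\<in>P. (f \<pi>)\<^sup>2)" using neg by simp
    finally have \<mu>: "\<mu> < lam" using pos by simp
    have Eg: "E g = 2 * \<mu> * (\<Sum>\<pi>\<in>P. (g \<pi>)\<^sup>2)"
    proof -
      have "E g = 2 * (\<Sum>\<pi>\<in>P. g \<pi> * L g \<pi>)" by (simp add: Lform E_def)
      also have "(\<Sum>\<pi>\<in>P. g \<pi> * L g \<pi>) = (\<Sum>\<pi>\<in>P. \<mu> * (g \<pi>)\<^sup>2)"
        by (intro sum.cong refl) (simp add: g(3) power2_eq_square)
      finally show ?thesis by (simp add: sum_distrib_left mult.assoc)
    qed
    \<comment> \<open>Otherwise conditioning \<open>g\<close> on the position of \<open>m\<close> gives a random walk eigenfunction below the gap.\<close>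
    have zero: "(\<Sum>\<pi>\<in>P. if \<pi> i = m then g \<pi> else 0) = 0" if "i \<in> V" "m \<in> V" for i m
    proof (rule ccontr)
      assume ne: "\<not> ?thesis"
      define x where "x i = (\<Sum>\<pi>\<in>P. if \<pi> i = m then g \<pi> else 0)" for i
      have "sum x V = (\<Sum>\<pi>\<in>P. \<Sum>i\<in>V. if \<pi> i = m then g \<pi> else 0)"
        unfolding x_def by (rule sum.swap)
      also have "\<dots> = (\<Sum>\<pi>\<in>P. g \<pi>)"
      proof (intro sum.cong refl)
        fix \<pi> assume "\<pi> \<in> P"
        then have \<pi>: "\<pi> permutes V" by (simp add: P_def)
        have "\<pi> i = m \<longleftrightarrow> i = inv_into UNIV \<pi> m" for i using \<pi> by (metis permutes_inverses)
        then show "(\<Sum>i\<in>V. if \<pi> i = m then g \<pi> else 0) = g \<pi>"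
          using V that permutes_in_image[OF permutes_inv[OF \<pi>]] by simp
      qed
      finally have x0: "sum x V = 0" using g(2) by simp
      have shift: "(\<Sum>\<pi>\<in>P. if \<pi> i = m then g (\<pi> \<circ> tr j k) else 0) = x (tr j k i)" if "j \<in> V"
          "k \<in> V" for i j k
        using sum_perm_tr[OF that, of "\<lambda>\<pi>. if \<pi> (tr j k i) = m then g \<pi> else 0"]
        by (simp add: P_def x_def)
      have rw_eigen: "\<mu> * x i = (\<Sum>j\<in>V. \<Sum>k\<in>V. b j k * (x i - x (tr j k i)))" for i
      proof -
        have "\<mu> * x i = (\<Sum>\<pi>\<in>P. if \<pi> i = m then L g \<pi> else 0)"
          unfolding x_def sum_distrib_left by (intro sum.cong refl) (simp add: g(3))
        also have "\<dots> = (\<Sum>\<pi>\<in>P. \<Sum>j\<in>V. \<Sum>k\<in>V. b j k * ((if \<pi> i = m then g \<pi> else 0) - (if \<pi> i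
            = m then g (\<pi> \<circ> tr j k) else 0)))"
          unfolding L_def by (intro sum.cong refl) auto
        also have "\<dots> = (\<Sum>j\<in>V. \<Sum>k\<in>V. b j k * (x i - x (tr j k i)))"
          unfolding swapPV by (intro sum.cong refl) (simp add: sum_distrib_left[symmetric] sum_subtractf shift x_def[of i, symmetric])
        finally show ?thesis .
      qed
      have "\<mu> * (\<Sum>i\<in>V. (x i)\<^sup>2) = (\<Sum>i\<in>V. x i * (\<mu> * x i))"
        by (simp add: sum_distrib_left power2_eq_square mult.left_commute)
      also have "\<dots> = (\<Sum>i\<in>V. \<Sum>j\<in>V. \<Sum>k\<in>V. b j k * (x i * (x i - x (tr j k i))))"
        unfolding rw_eigen sum_distrib_left by (simp add: mult.left_commute)
      also have "\<dots> = (\<Sum>j\<in>V. \<Sum>k\<in>V. \<Sum>i\<in>V. b j k * (x i * (x i - x (tr j k i))))"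
        by (subst sum.swap, rule sum.cong[OF refl], rule sum.swap)
      also have "\<dots> = (\<Sum>j\<in>V. \<Sum>k\<in>V. b j k * (x j - x k)\<^sup>2)"
        by (intro sum.cong refl) (simp add: sum_distrib_left[symmetric] sum_tr_form V)
      also have "\<dots> \<ge> lam * (\<Sum>i\<in>V. (x i)\<^sup>2)"
        using insert.prems(3)[of x] x0 by (simp add: V_def)
      finally have "lam * (\<Sum>i\<in>V. (x i)\<^sup>2) \<le> \<mu> * (\<Sum>i\<in>V. (x i)\<^sup>2)" .
      moreover have "(\<Sum>i\<in>V. (x i)\<^sup>2) > 0"
        using ne V \<open>i \<in> V\<close> by (auto intro!: sum_pos2[of _ i] simp: x_def)
      ultimately show False using \<mu> by simp
    qed
    \<comment> \<open>Each permutation of \<open>V\<close> is uniquely \<open>tr n m\<close> after a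
      permutation of \<open>S\<close>, with \<open>m\<close> the image of \<open>n\<close>.
      Transpositions of positions in \<open>S\<close> preserve these slices, and by
      \<open>zero\<close> the function \<open>g\<close> has mean zero on each of them.\<close>
    define G where "G m q = g (tr n m \<circ> q)" for m q
    have P_sum: "(\<Sum>\<pi>\<in>P. F \<pi>) = (\<Sum>m\<in>V. \<Sum>q | q permutes S. F (tr n m \<circ> q))" for F :: "_ \<Rightarrow> real"
      unfolding P_def V_def by (rule sum_over_permutations_insert) fact+
    have G0: "(\<Sum>q | q permutes S. G m q) = 0" if "m \<in> V" for m
    proof -
      have "(\<Sum>\<pi>\<in>P. if \<pi> n = m then g \<pi> else 0) = (\<Sum>m'\<in>V. if m'
          = m then \<Sum>q | q permutes S. G m' q else 0)"
        unfolding P_sum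
      proof (intro sum.cong refl)
        fix m'
        have "(\<Sum>q | q permutes S. if (tr n m' \<circ> q) n = m then g (tr n m' \<circ> q) else 0)
            = (\<Sum>q | q permutes S. if m' = m then G m' q else 0)"
        proof (intro sum.cong refl)
          fix q assume "q \<in> {q. q permutes S}"
          then have "q n = n" using \<open>n \<notin> S\<close> by (simp add: permutes_not_in)
          then show "(if (tr n m' \<circ> q) n = m then g (tr n m' \<circ> q) else 0) = (if m'
              = m then G m' q else 0)"
            by (simp add: G_def)
        qed
        then show "(\<Sum>q | q permutes S. if (tr n m' \<circ> q) n = m then g (tr n m' \<circ> q) else 0)
            = (if m' = m then \<Sum>q | q permutes S. G m' q else 0)"
          by simp
      qed
      also have "\<dots> = (\<Sum>q | q permutes S. G m q)" using V that by simp
      finally show ?thesis using zero[of n m] that by (simp add: V_def)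
    qed
    have trG: "swap_energy V g i j = (\<Sum>m\<in>V. swap_energy S (G m) i j)" for i j
      using P_sum[of "\<lambda>\<pi>. (g (\<pi> \<circ> tr i j) - g \<pi>)\<^sup>2"]
          by (simp add: swap_energy_def P_def G_def comp_assoc)
    define b' where "b' i j = b i j + b n i * b n j / sum (b n) S" for i j
    have snn: "sum (b n) S \<ge> 0" using nn by (intro sum_nonneg) (auto simp: V_def)
    have IH: "2 * lam * (\<Sum>q | q permutes S. (G m q)\<^sup>2) \<le> (\<Sum>i\<in>S. \<Sum>j\<in>S. b' i j
        * swap_energy S (G m) i j)" if "m \<in> V" for m
    proof (rule insert.IH)
      show "b' i j = b' j i" for i j using insert.prems(1) by (simp add: b'_def mult.commute)
      show "b' i j \<ge> 0" if "i \<in> S" "j \<in> S" for i j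
        using nn that snn by (auto simp: b'_def V_def)
      show "lam * (\<Sum>i\<in>S. (x i)\<^sup>2) \<le> (\<Sum>i\<in>S. \<Sum>j\<in>S. b' i j * (x i - x j)\<^sup>2)" if "sum x S = 0" for x
        unfolding b'_def by (rule reduced_gap) (use insert that in auto)
    qed (rule G0[OF that])
    have oct: "(\<Sum>i\<in>S. \<Sum>j\<in>S. b n i * b n j / sum (b n) S * swap_energy V g i j) \<le> 2 * (\<Sum>i\<in>S. b n i
        * swap_energy V g i n)"
    proof (cases "sum (b n) S = 0")
      case True
      then show ?thesis using nn by (simp add: swap_energy_def sum_nonneg V_def)
    next
      case False
      have "(\<Sum>i\<in>S. \<Sum>j\<in>S. b n i * b n j * swap_energy V g i j) \<le> 2 * sum (b n) S * (\<Sum>i\<in>S. b n i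
          * swap_energy V g i n)"
        unfolding V_def by (rule octopus) (use insert nn in \<open>auto simp: V_def\<close>)
      then have "(\<Sum>i\<in>S. \<Sum>j\<in>S. b n i * b n j * swap_energy V g i j) / sum (b n) S \<le> 2
          * (\<Sum>i\<in>S. b n i * swap_energy V g i n)"
        using False snn by (simp add: divide_le_eq mult_ac)
      then show ?thesis by (simp add: sum_divide_distrib)
    qed
    \<comment> \<open>Summed over the slices, the induction hypothesis and the octopus inequality
      give energy at least \<open>2 * lam\<close> times the squared norm of \<open>g\<close>,
      whereas \<open>Eg\<close> gives exactly \<open>2 * \<mu>\<close> times it.\<close>
    have "2 * lam * (\<Sum>\<pi>\<in>P. (g \<pi>)\<^sup>2) = (\<Sum>m\<in>V. 2 * lam * (\<Sum>q | q permutes S. (G m q)\<^sup>2))"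
      by (simp add: P_sum G_def sum_distrib_left)
    also have "\<dots> \<le> (\<Sum>m\<in>V. \<Sum>i\<in>S. \<Sum>j\<in>S. b' i j * swap_energy S (G m) i j)"
      by (intro sum_mono IH)
    also have "\<dots> = (\<Sum>i\<in>S. \<Sum>j\<in>S. \<Sum>m\<in>V. b' i j * swap_energy S (G m) i j)"
      by (subst sum.swap, rule sum.cong[OF refl], rule sum.swap)
    also have "\<dots> = (\<Sum>i\<in>S. \<Sum>j\<in>S. b' i j * swap_energy V g i j)"
      by (simp add: trG sum_distrib_left)
    also have "\<dots> = (\<Sum>i\<in>S. \<Sum>j\<in>S. b i j * swap_energy V g i j) + (\<Sum>i\<in>S. \<Sum>j\<in>S. b n i
        * b n j / sum (b n) S * swap_energy V g i j)"
      by (simp add: b'_def distrib_right sum.distrib)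
    also have "\<dots> \<le> (\<Sum>i\<in>S. \<Sum>j\<in>S. b i j * swap_energy V g i j) + 2 * (\<Sum>i\<in>S. b n i
        * swap_energy V g i n)"
      using oct by simp
    also have "\<dots> = E g"
    proof -
      have V_sum: "(\<Sum>i\<in>V. h i) = h n + (\<Sum>i\<in>S. h i)" for h :: "'a \<Rightarrow> real"
        using insert.hyps by (simp add: V_def)
      have nn: "swap_energy V g n n = 0" and ns: "swap_energy V g n j = swap_energy V g j n" for j
        by (simp_all add: swap_energy_def transpose_commute)
      have "(\<Sum>i\<in>S. b i n * swap_energy V g i n) = (\<Sum>i\<in>S. b n i * swap_energy V g i n)"
        by (intro sum.cong refl) (simp add: insert.prems(1))
      then show ?thesis
        unfolding E_def V_sum nn unfolding ns by (simp add: sum.distrib)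
    qed
    finally show False using Eg pos \<mu> by simp
  qed
qed

section \<open>Functions on the hyperoctahedral group and the killed random walk\<close>

lemma sum_involution_adj:
  fixes u v :: "'g \<Rightarrow> real"
  assumes "\<And>g. g \<in> C \<Longrightarrow> S g \<in> C" "\<And>g. g \<in> C \<Longrightarrow> S (S g) = g"
  shows "(\<Sum>g\<in>C. u g * v (S g)) = (\<Sum>g\<in>C. u (S g) * v g)"
  by (rule sum.reindex_bij_witness[of _ S S]) (auto simp: assms)

lemma sum_involution_diff:
  fixes u v :: "'g \<Rightarrow> real"
  assumes "\<And>g. g \<in> C \<Longrightarrow> S g \<in> C" "\<And>g. g \<in> C \<Longrightarrow> S (S g) = g"
  shows "(\<Sum>g\<in>C. u g * (v g - v (S g))) = (\<Sum>g\<in>C. (u g - u (S g)) * (v g - v (S g))) / 2"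
proof -
  have "(\<Sum>g\<in>C. u (S g) * v (S g)) = (\<Sum>g\<in>C. u g * v g)"
    by (rule sum.reindex_bij_witness[of _ S S]) (auto simp: assms)
  then show ?thesis using sum_involution_adj[OF assms, of u v]
    by (simp add: algebra_simps sum.distrib sum_subtractf)
qed

text \<open>The function \<open>p i\<close> in the proof projects \<open>f\<close> to the functions
  odd under \<open>S i\<close>, so its inner product with \<open>f\<close> is
  \<open>(y i)\<^sup>2\<close>. The projections commute, and \<open>T k l\<close> carries the
  projection of an index to that of the exchanged index.\<close>

lemma killed_walk_energy_le:
  fixes f :: "'g \<Rightarrow> real" and S :: "'i \<Rightarrow> 'g \<Rightarrow> 'g" and T :: "'i \<Rightarrow> 'i \<Rightarrow> 'g \<Rightarrow> 'g"
  assumes "finite C" "finite I"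
    and S: "\<And>i g. i \<in> I \<Longrightarrow> g \<in> C \<Longrightarrow> S i g \<in> C" "\<And>i g. i \<in> I \<Longrightarrow> g \<in> C \<Longrightarrow> S i (S i g) = g"
    and SS: "\<And>i j g. i \<in> I \<Longrightarrow> j \<in> I \<Longrightarrow> g \<in> C \<Longrightarrow> S i (S j g) = S j (S i g)"
    and T: "\<And>k l g. k \<in> I \<Longrightarrow> l \<in> I \<Longrightarrow> g \<in> C \<Longrightarrow> T k l g \<in> C" "\<And>k l g. k \<in> I \<Longrightarrow> l \<in> I \<Longrightarrow> g \<in> C
        \<Longrightarrow> T k l (T k l g) = g"
    and T1: "\<And>k g. k \<in> I \<Longrightarrow> g \<in> C \<Longrightarrow> T k k g = g"
    and ST: "\<And>i k l g. \<lbrakk>i \<in> I; k \<in> I; l \<in> I; g \<in> C\<rbrakk> \<Longrightarrow> S i (T k l g) = T k l (S (tr k l i) g)"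
    and a: "\<And>i. i \<in> I \<Longrightarrow> a i \<ge> 0" and c: "\<And>k l. k \<in> I \<Longrightarrow> l \<in> I \<Longrightarrow> c k l \<ge> 0"
    and eigen: "\<And>g. g \<in> C \<Longrightarrow> (\<Sum>i\<in>I. a i * (f g - f (S i g))) + (\<Sum>k\<in>I. \<Sum>l\<in>I. c k l * (f g
        - f (T k l g))) = x * f g"
  defines "y \<equiv> \<lambda>i. L2_set (\<lambda>g. (f g - f (S i g)) / 2) C"
  shows "2 * (\<Sum>i\<in>I. a i * (y i)\<^sup>2) + (\<Sum>k\<in>I. \<Sum>l\<in>I. c k l * (y k - y l)\<^sup>2) \<le> x * (\<Sum>i\<in>I. (y i)\<^sup>2)"
proof -
  define p where "p i g = (f g - f (S i g)) / 2" for i g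
  define In where "In u v = (\<Sum>g\<in>C. u g * (v g :: real))" for u v
  have y2: "(y i)\<^sup>2 = In (p i) (p i)" for i
    by (simp add: y_def p_def In_def L2_set_def sum_nonneg power2_eq_square)
  have pf: "In (p i) f = (y i)\<^sup>2" if "i \<in> I" for i
    using sum_involution_diff[of C "S i" f f] that S
    by (simp add: y2 In_def p_def mult.commute[of _ "f _"] sum_divide_distrib[symmetric])
  \<comment> \<open>For commuting projections the inner product of two images of \<open>f\<close> is
    the squared norm of its image under their product; 16 is the square of the two halvings.\<close>
  have pp: "In (p i) (p j) \<ge> 0" if "i \<in> I" "j \<in> I" for i j
  proof -
    define e where "e g = f g - f (S j g)" for g
    have "In (p i) (p j) = (\<Sum>g\<in>C. p i g * (f g - f (S j g))) / 2"
      by (simp add: In_def p_def[of j] sum_divide_distrib)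
    also have "\<dots> = (\<Sum>g\<in>C. (p i g - p i (S j g)) * (f g - f (S j g))) / 4"
      using that S by (subst sum_involution_diff) auto
    also have "\<dots> = (\<Sum>g\<in>C. e g * (e g - e (S i g))) / 8"
    proof -
      have "p i g - p i (S j g) = (e g - e (S i g)) / 2" if "g \<in> C" for g
        using SS[OF \<open>i \<in> I\<close> \<open>j \<in> I\<close> that] by (simp add: p_def e_def field_simps)
      then show ?thesis
        unfolding sum_divide_distrib e_def[symmetric]
            by (intro sum.cong refl) (simp add: mult.commute)
    qed
    also have "\<dots> = (\<Sum>g\<in>C. (e g - e (S i g)) * (e g - e (S i g))) / 16"
      using that S by (subst sum_involution_diff) auto
    also have "\<dots> \<ge> 0" by (simp add: sum_nonneg)
    finally show ?thesis .
  qed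
  have diag: "(\<Sum>i\<in>I. a i * (y i)\<^sup>2) \<le> (\<Sum>i\<in>I. \<Sum>j\<in>I. a j * In (p i) (p j))"
  proof (intro sum_mono)
    fix i assume "i \<in> I"
    have "a i * (y i)\<^sup>2 = a i * In (p i) (p i)" by (simp add: y2)
    also have "\<dots> \<le> (\<Sum>j\<in>I. a j * In (p i) (p j))"
      using \<open>i \<in> I\<close> \<open>finite I\<close> a pp by (intro member_le_sum[of i I "\<lambda>j. a j * In (p i) (p j)"]) auto
    finally show "a i * (y i)\<^sup>2 \<le> (\<Sum>j\<in>I. a j * In (p i) (p j))" .
  qed
  \<comment> \<open>Indices other than \<open>k\<close> and \<open>l\<close> contribute
    nonnegatively, because their projections commute with \<open>T k l\<close>; the two remaining
    terms together dominate the square.\<close>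
  have hop: "(y k - y l)\<^sup>2 \<le> (\<Sum>i\<in>I. In (p i) (\<lambda>g. f g - f (T k l g)))" if kl: "k \<in> I" "l \<in> I"
      for k l
  proof (cases "k = l")
    case True
    then have "In (p i) (\<lambda>g. f g - f (T k l g)) = 0" for i
      using that T1 by (simp add: In_def)
    then show ?thesis using True by simp
  next
    case False
    let ?d = "\<lambda>g. f g - f (T k l g)"
    have other: "In (p i) ?d \<ge> 0" if "i \<in> I - {k, l}" for i
    proof -
      have i: "i \<in> I" "tr k l i = i" using that by (auto simp: Transposition.transpose_def)
      have "In (p i) ?d = (\<Sum>g\<in>C. (p i g - p i (T k l g)) * (f g - f (T k l g))) / 2"
        unfolding In_def using kl T by (subst sum_involution_diff) auto
      also have "\<dots> = (\<Sum>g\<in>C. ?d g * (?d g - ?d (S i g))) / 4"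
        unfolding sum_divide_distrib using i kl
        by (intro sum.cong refl) (simp add: p_def ST field_simps)
      also have "\<dots> = (\<Sum>g\<in>C. (?d g - ?d (S i g)) * (?d g - ?d (S i g))) / 8"
        using i S by (subst sum_involution_diff) auto
      also have "\<dots> \<ge> 0" by (simp add: sum_nonneg)
      finally show ?thesis .
    qed
    \<comment> \<open>Because \<open>p i\<close> is odd under \<open>S i\<close>, only the odd part
      of the other factor counts. This is \<open>p j\<close> transported by \<open>T k l\<close>,
      which preserves the norm, so Cauchy-Schwarz applies.\<close>
    have cross: "In (p i) (\<lambda>g. f (T k l g)) \<le> y i * y j" if "i \<in> I" "j \<in> I" "tr k l i = j" for i j
    proof -
      have odd: "p i (S i g) = - p i g" if "g \<in> C" for g
        using S \<open>i \<in> I\<close> that by (simp add: p_def field_simps)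
      have "In (p i) (\<lambda>g. f (T k l g)) = (\<Sum>g\<in>C. p i g * p j (T k l g))"
      proof -
        have "(\<Sum>g\<in>C. p i g * f (T k l (S i g))) = (\<Sum>g\<in>C. p i (S i g) * f (T k l g))"
          using \<open>i \<in> I\<close> S by (intro sum_involution_adj) auto
        also have "\<dots> = - In (p i) (\<lambda>g. f (T k l g))"
          by (simp add: odd In_def sum_negf)
        finally have *: "(\<Sum>g\<in>C. p i g * f (T k l (S i g))) = - In (p i) (\<lambda>g. f (T k l g))" .
        have "S j (T k l g) = T k l (S i g)" if "g \<in> C" for g
          using ST[of j k l g] kl that \<open>j \<in> I\<close> \<open>tr k l i = j\<close> by auto
        then have "(\<Sum>g\<in>C. p i g * p j (T k l g)) = (\<Sum>g\<in>C. p i g * f (T k l g) - p i g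
            * f (T k l (S i g))) / 2"
          unfolding sum_divide_distrib by (intro sum.cong refl) (simp add: p_def[of j] field_simps)
        then show ?thesis using * by (simp add: sum_subtractf In_def)
      qed
      also have "\<dots> \<le> (\<Sum>g\<in>C. \<bar>p i g\<bar> * \<bar>p j (T k l g)\<bar>)"
        by (intro sum_mono) (simp add: abs_mult[symmetric])
      also have "\<dots> \<le> L2_set (p i) C * L2_set (\<lambda>g. p j (T k l g)) C"
        by (rule L2_set_mult_ineq)
      also have "L2_set (\<lambda>g. p j (T k l g)) C = L2_set (p j) C"
        unfolding L2_set_def using kl T
        by (intro arg_cong[where f = sqrt] sum.reindex_bij_witness[of _ "T k l" "T k l"]) auto
      finally show ?thesis by (simp add: y_def p_def[abs_def])
    qed
    have "In (p i) ?d = (y i)\<^sup>2 - In (p i) (\<lambda>g. f (T k l g))" if "i \<in> I" for i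
      using pf[OF that] by (simp add: In_def right_diff_distrib sum_subtractf)
    then have "(y k)\<^sup>2 - y k * y l \<le> In (p k) ?d" "(y l)\<^sup>2 - y l * y k \<le> In (p l) ?d"
      using cross[of k l] cross[of l k] kl by auto
    then have "(y k - y l)\<^sup>2 \<le> In (p k) ?d + In (p l) ?d"
      by (simp add: power2_eq_square algebra_simps)
    also have "\<dots> = (\<Sum>i\<in>{k, l}. In (p i) ?d)" using False by simp
    also have "\<dots> \<le> (\<Sum>i\<in>I. In (p i) ?d)"
      using kl other \<open>finite I\<close> by (intro sum_mono2) auto
    finally show ?thesis .
  qed
  have "x * (\<Sum>i\<in>I. (y i)\<^sup>2) = (\<Sum>i\<in>I. \<Sum>g\<in>C. p i g * (x * f g))"
    by (simp add: pf[symmetric] In_def sum_distrib_left mult.left_commute)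
  also have "\<dots> = (\<Sum>i\<in>I. \<Sum>g\<in>C. p i g * ((\<Sum>j\<in>I. a j * (2 * p j g)) + (\<Sum>k\<in>I. \<Sum>l\<in>I. c k l * (f g
      - f (T k l g)))))"
  proof -
    have two: "2 * p j g = f g - f (S j g)" for j g by (simp add: p_def)
    show ?thesis unfolding two by (intro sum.cong refl) (simp add: eigen)
  qed
  also have "\<dots> = 2 * (\<Sum>i\<in>I. \<Sum>j\<in>I. a j * In (p i) (p j))
      + (\<Sum>i\<in>I. \<Sum>k\<in>I. \<Sum>l\<in>I. c k l * In (p i) (\<lambda>g. f g - f (T k l g)))"
  proof -
    have 1: "(\<Sum>g\<in>C. p i g * (\<Sum>j\<in>I. a j * (2 * p j g))) = 2 * (\<Sum>j\<in>I. a j * In (p i) (p j))" for i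
      unfolding In_def sum_distrib_left by (subst sum.swap) (simp add: mult_ac)
    have 2: "(\<Sum>g\<in>C. p i g * (\<Sum>k\<in>I. \<Sum>l\<in>I. c k l * (f g - f (T k l g))))
       = (\<Sum>k\<in>I. \<Sum>l\<in>I. c k l * In (p i) (\<lambda>g. f g - f (T k l g)))" for i
      unfolding In_def sum_distrib_left
      by (subst sum.swap, rule sum.cong[OF refl], subst sum.swap) (simp add: mult.left_commute)
    show ?thesis by (simp add: distrib_left sum.distrib 1 2 sum_distrib_left[symmetric])
  qed
  also have "(\<Sum>i\<in>I. \<Sum>k\<in>I. \<Sum>l\<in>I. c k l * In (p i) (\<lambda>g. f g - f (T k l g)))
     = (\<Sum>k\<in>I. \<Sum>l\<in>I. c k l * (\<Sum>i\<in>I. In (p i) (\<lambda>g. f g - f (T k l g))))"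
    unfolding sum_distrib_left by (subst sum.swap, rule sum.cong[OF refl], subst sum.swap) simp
  finally have "x * (\<Sum>i\<in>I. (y i)\<^sup>2) = 2 * (\<Sum>i\<in>I. \<Sum>j\<in>I. a j * In (p i) (p j))
     + (\<Sum>k\<in>I. \<Sum>l\<in>I. c k l * (\<Sum>i\<in>I. In (p i) (\<lambda>g. f g - f (T k l g))))" .
  moreover have "(\<Sum>k\<in>I. \<Sum>l\<in>I. c k l * (y k - y l)\<^sup>2) \<le> (\<Sum>k\<in>I. \<Sum>l\<in>I. c k l
      * (\<Sum>i\<in>I. In (p i) (\<lambda>g. f g - f (T k l g))))"
    by (intro sum_mono mult_left_mono hop c)
  ultimately show ?thesis using diag by linarith
qed

text \<open>Up to sign this is the generator of a walk with jumps along transpositions and killing.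
  The factor 2 is the change of an odd function under a sign flip.\<close>

definition killed_walk :: "'i set \<Rightarrow> ('i \<Rightarrow> real) \<Rightarrow> ('i \<Rightarrow> 'i \<Rightarrow> real) \<Rightarrow> ('i \<Rightarrow> real) \<Rightarrow> 'i \<Rightarrow> real" where
  "killed_walk I a c z i = 2 * a i * z i + (\<Sum>k\<in>I. \<Sum>l\<in>I. c k l * (z i - z (tr k l i)))"

lemma killed_walk_form:
  assumes "finite I"
  shows "(\<Sum>i\<in>I. z i * killed_walk I a c z i) = 2 * (\<Sum>i\<in>I. a i * (z i)\<^sup>2) + (\<Sum>k\<in>I. \<Sum>l\<in>I. c k l
      * (z k - z l)\<^sup>2)"
proof -
  have "(\<Sum>i\<in>I. z i * killed_walk I a c z i)
      = 2 * (\<Sum>i\<in>I. a i * (z i)\<^sup>2) + (\<Sum>i\<in>I. \<Sum>k\<in>I. \<Sum>l\<in>I. c k l * (z i * (z i - z (tr k l i))))"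
    by (simp add: killed_walk_def distrib_left sum.distrib sum_distrib_left power2_eq_square mult_ac)
  also have "(\<Sum>i\<in>I. \<Sum>k\<in>I. \<Sum>l\<in>I. c k l * (z i * (z i - z (tr k l i))))
      = (\<Sum>k\<in>I. \<Sum>l\<in>I. \<Sum>i\<in>I. c k l * (z i * (z i - z (tr k l i))))"
    by (subst sum.swap, rule sum.cong[OF refl], rule sum.swap)
  also have "\<dots> = (\<Sum>k\<in>I. \<Sum>l\<in>I. c k l * (z k - z l)\<^sup>2)"
    using assms by (intro sum.cong refl) (simp add: sum_distrib_left[symmetric] sum_tr_form)
  finally show ?thesis .
qed

text \<open>The null vector \<open>e\<close> serves two cases: zero, without constraint, for odd
  functions, and the constant 1 together with zero killing, to exclude the constants, for even
  functions.\<close>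

lemma killed_walk_minimiser:
  fixes I :: "'i set"
  assumes "finite I" and e: "\<And>i. i \<in> I \<Longrightarrow> killed_walk I a c e i = 0"
    and z0: "(\<Sum>i\<in>I. z0 i * e i) = 0" "\<exists>i\<in>I. z0 i \<noteq> 0"
  obtains \<mu> z where "\<exists>i\<in>I. z i \<noteq> 0" "(\<Sum>i\<in>I. z i * e i) = 0"
    "\<And>i. i \<in> I \<Longrightarrow> killed_walk I a c z i = \<mu> * z i"
    "\<And>y. (\<Sum>i\<in>I. y i * e i) = 0 \<Longrightarrow>
      \<mu> * (\<Sum>i\<in>I. (y i)\<^sup>2) \<le> 2 * (\<Sum>i\<in>I. a i * (y i)\<^sup>2) + (\<Sum>k\<in>I. \<Sum>l\<in>I. c k l * (y k - y l)\<^sup>2)"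
proof (rule Rayleigh_minimiser[of I "killed_walk I a c" e 0 z0])
  show "killed_walk I a c (\<lambda>j. x j + t * y j) i = killed_walk I a c x i + t
      * killed_walk I a c y i" for x y t i
    by (simp add: killed_walk_def algebra_simps sum.distrib sum_subtractf sum_distrib_left)
  show "continuous_on UNIV (\<lambda>x. killed_walk I a c x i)" for i
    unfolding killed_walk_def by (intro continuous_intros continuous_on_product_coordinates)
  show "(\<Sum>i\<in>I. x i * killed_walk I a c y i) = (\<Sum>i\<in>I. killed_walk I a c x i * y i)" for x y
  proof -
    have adj: "(\<Sum>i\<in>I. x i * y (tr k l i)) = (\<Sum>i\<in>I. x (tr k l i) * y i)" if "k \<in> I" "l \<in> I" for k l
      by (rule sum_involution_adj) (use that in \<open>auto simp: Transposition.transpose_def\<close>)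
    have "(\<Sum>i\<in>I. x i * killed_walk I a c y i) = (\<Sum>i\<in>I. 2 * a i * x i * y i)
       + (\<Sum>i\<in>I. \<Sum>k\<in>I. \<Sum>l\<in>I. c k l * (x i * y i - x i * y (tr k l i)))"
      by (simp add: killed_walk_def distrib_left sum.distrib sum_distrib_left right_diff_distrib mult_ac)
    also have "(\<Sum>i\<in>I. \<Sum>k\<in>I. \<Sum>l\<in>I. c k l * (x i * y i - x i * y (tr k l i)))
        = (\<Sum>k\<in>I. \<Sum>l\<in>I. c k l * ((\<Sum>i\<in>I. x i * y i) - (\<Sum>i\<in>I. x i * y (tr k l i))))"
      unfolding sum_distrib_left sum_subtractf[symmetric]
      by (subst sum.swap, rule sum.cong[OF refl], subst sum.swap) (simp add: sum_distrib_left sum_subtractf right_diff_distrib)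
    also have "\<dots> = (\<Sum>k\<in>I. \<Sum>l\<in>I. c k l * ((\<Sum>i\<in>I. x i * y i) - (\<Sum>i\<in>I. x (tr k l i) * y i)))"
      by (intro sum.cong refl) (simp add: adj)
    also have "\<dots> = (\<Sum>i\<in>I. \<Sum>k\<in>I. \<Sum>l\<in>I. c k l * (x i * y i - x (tr k l i) * y i))"
      unfolding sum_distrib_left sum_subtractf[symmetric]
      by (subst sum.swap[of _ I I], rule sum.cong[OF refl], subst sum.swap) (simp add: sum_distrib_left sum_subtractf right_diff_distrib)
    also have "(\<Sum>i\<in>I. 2 * a i * x i * y i) + \<dots> = (\<Sum>i\<in>I. killed_walk I a c x i * y i)"
      unfolding sum.distrib[symmetric]
    proof (intro sum.cong refl)
      show "2 * a i * x i * y i + (\<Sum>k\<in>I. \<Sum>l\<in>I. c k l * (x i * y i - x (tr k l i) * y i))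
          = killed_walk I a c x i * y i" for i
        unfolding killed_walk_def distrib_right sum_distrib_right
            by (simp add: left_diff_distrib mult.assoc)
    qed
    finally show ?thesis .
  qed
qed (use assms in \<open>auto simp: killed_walk_form\<close>)

section \<open>The signed permutation representation\<close>

abbreviation (input) signs where "signs n \<equiv> {1..n} \<rightarrow>\<^sub>E {0, 1::nat}"

lemma hyp_carrier: "carrier (hyperoctahedral n) = signs n \<times> {\<pi>. \<pi> permutes {1..n}}"
  by (simp add: hyperoctahedral_def)

lemma hyp_mult: "(\<eta>, \<pi>) \<otimes>\<^bsub>hyperoctahedral n\<^esub> (\<zeta>, \<sigma>)
    = (\<lambda>i\<in>{1..n}. (\<eta> i + \<zeta> (inv_into UNIV \<pi> i)) mod 2, \<pi> \<circ> \<sigma>)"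
  by (simp add: hyperoctahedral_def)

lemma hyp_one: "\<one>\<^bsub>hyperoctahedral n\<^esub> = (\<lambda>i\<in>{1..n}. 0, id)"
  by (simp add: hyperoctahedral_def)

lemma finite_hyp: "finite (carrier (hyperoctahedral n))"
  unfolding hyp_carrier by (intro finite_cartesian_product finite_PiE finite_permutations) auto

lemma signs_mod2: "\<eta> \<in> signs n \<Longrightarrow> i \<in> {1..n} \<Longrightarrow> \<eta> i mod 2 = \<eta> i"
  by (drule PiE_mem) auto

lemma mod2_signs: "(\<lambda>i\<in>{1..n}. f i mod 2) \<in> signs n"
  by (auto simp: PiE_iff)

lemma group_hyp: "group (hyperoctahedral n)"
proof (rule groupI)
  fix x y z
  assume "x \<in> carrier (hyperoctahedral n)" "y \<in> carrier (hyperoctahedral n)"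
      "z \<in> carrier (hyperoctahedral n)"
  then obtain \<eta> \<pi> \<zeta> \<sigma> \<theta> \<rho> where x: "x = (\<eta>, \<pi>)" "y = (\<zeta>, \<sigma>)" "z = (\<theta>, \<rho>)"
    and p: "\<pi> permutes {1..n}" "\<sigma> permutes {1..n}" "\<rho> permutes {1..n}" and s: "\<eta> \<in> signs n"
        "\<zeta> \<in> signs n" "\<theta> \<in> signs n"
    by (cases x, cases y, cases z) (auto simp: hyp_carrier)
  have inv: "inv_into UNIV \<pi> i \<in> {1..n}" if "i \<in> {1..n}" for i
    using permutes_in_image[OF permutes_inv[OF p(1)]] that by simp
  have invc: "inv_into UNIV (\<pi> \<circ> \<sigma>) i = inv_into UNIV \<sigma> (inv_into UNIV \<pi> i)" for i
    using p by (simp add: o_inv_distrib permutes_bij)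
  show "x \<otimes>\<^bsub>hyperoctahedral n\<^esub> y \<otimes>\<^bsub>hyperoctahedral n\<^esub> z
      = x \<otimes>\<^bsub>hyperoctahedral n\<^esub> (y \<otimes>\<^bsub>hyperoctahedral n\<^esub> z)"
    unfolding x hyp_mult using inv
    by (auto simp: invc comp_assoc mod_add_left_eq mod_add_right_eq add.assoc intro!: restrict_ext)
next
  fix x y
  assume "x \<in> carrier (hyperoctahedral n)" "y \<in> carrier (hyperoctahedral n)"
  then show "x \<otimes>\<^bsub>hyperoctahedral n\<^esub> y \<in> carrier (hyperoctahedral n)"
    by (cases x, cases y) (auto simp: hyp_carrier hyp_mult permutes_compose)
next
  show "\<one>\<^bsub>hyperoctahedral n\<^esub> \<in> carrier (hyperoctahedral n)"
    by (auto simp: hyp_carrier hyp_one permutes_id)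
next
  fix x assume "x \<in> carrier (hyperoctahedral n)"
  then obtain \<eta> \<pi> where x: "x = (\<eta>, \<pi>)" "\<pi> permutes {1..n}" "\<eta> \<in> signs n"
    by (cases x) (auto simp: hyp_carrier)
  show "\<one>\<^bsub>hyperoctahedral n\<^esub> \<otimes>\<^bsub>hyperoctahedral n\<^esub> x = x"
    unfolding x hyp_one hyp_mult using signs_mod2[OF x(3)] PiE_restrict[OF x(3)]
    by (simp cong: restrict_cong)
  show "\<exists>y\<in>carrier (hyperoctahedral n). y \<otimes>\<^bsub>hyperoctahedral n\<^esub> x = \<one>\<^bsub>hyperoctahedral n\<^esub>"
  proof (rule bexI)
    show "(\<lambda>i\<in>{1..n}. \<eta> (\<pi> i), inv_into UNIV \<pi>) \<otimes>\<^bsub>hyperoctahedral n\<^esub> x = \<one>\<^bsub>hyperoctahedral n\<^esub>"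
      unfolding x hyp_one hyp_mult using x(2)
      by (auto simp: permutes_inv_o permutes_inv_inv intro!: restrict_ext)
    show "(\<lambda>i\<in>{1..n}. \<eta> (\<pi> i), inv_into UNIV \<pi>) \<in> carrier (hyperoctahedral n)"
      using x(2,3) permutes_in_image[OF x(2)] by (auto simp: hyp_carrier permutes_inv PiE_iff)
  qed
qed

section \<open>Right multiplication by the generators\<close>

lemma sign_flip_carrier: "i \<in> {1..n} \<Longrightarrow> sign_flip n i \<in> carrier (hyperoctahedral n)"
  by (auto simp: sign_flip_def hyp_carrier permutes_id)

lemma of_perm_carrier: "\<pi> permutes {1..n} \<Longrightarrow> of_perm n \<pi> \<in> carrier (hyperoctahedral n)"
  by (auto simp: of_perm_def hyp_carrier)

text \<open>Moving the flip past the permutation conjugates it, so the sign that changes sits at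
  \<open>\<pi> i\<close>.\<close>

lemma mult_sign_flip:
  assumes "\<pi> permutes {1..n}" "i \<in> {1..n}"
  shows "(\<eta>, \<pi>) \<otimes>\<^bsub>hyperoctahedral n\<^esub> sign_flip n i = (\<lambda>j\<in>{1..n}. (\<eta> j + (if j
      = \<pi> i then 1 else 0)) mod 2, \<pi>)"
proof -
  have "inv_into UNIV \<pi> j \<in> {1..n}" "inv_into UNIV \<pi> j = i \<longleftrightarrow> j = \<pi> i" if "j \<in> {1..n}" for j
    using that permutes_inverses[OF assms(1)]
        by (simp_all only: permutes_in_image[OF permutes_inv[OF assms(1)]]) metis
  then show ?thesis by (auto simp: sign_flip_def hyp_mult intro!: restrict_ext)
qed

lemma mult_of_perm:
  assumes "\<pi> permutes {1..n}" "\<eta> \<in> signs n"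
  shows "(\<eta>, \<pi>) \<otimes>\<^bsub>hyperoctahedral n\<^esub> of_perm n \<sigma> = (\<eta>, \<pi> \<circ> \<sigma>)"
proof -
  have "inv_into UNIV \<pi> j \<in> {1..n}" if "j \<in> {1..n}" for j
    using permutes_in_image[OF permutes_inv[OF assms(1)]] that by auto
  then show ?thesis using signs_mod2[OF assms(2)] PiE_restrict[OF assms(2)]
    by (simp add: of_perm_def hyp_mult cong: restrict_cong)
qed

section \<open>The action on signed points\<close>

definition points :: "nat \<Rightarrow> int set" where "points n = {p. p \<noteq> 0 \<and> \<bar>p\<bar> \<le> int n}"

lemma bij_signed_point: "bij_betw (signed_point n) {0..<2 * n} (points n)"
proof (rule bij_betw_byWitness[where f' = "\<lambda>p. nat (if p < 0 then p + int n else p + int n - 1)"])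
  show "\<forall>m\<in>{0..<2 * n}. nat (if signed_point n m < 0 then signed_point n m
      + int n else signed_point n m + int n - 1) = m"
    by (auto simp: signed_point_def)
  show "\<forall>p\<in>points n. signed_point n (nat (if p < 0 then p + int n else p + int n - 1)) = p"
    by (auto simp: signed_point_def points_def)
  show "signed_point n ` {0..<2 * n} \<subseteq> points n"
    by (auto simp: signed_point_def points_def)
  show "(\<lambda>p. nat (if p < 0 then p + int n else p + int n - 1)) ` points n \<subseteq> {0..<2 * n}"
    by (auto simp: points_def)
qed

lemma sum_signed_point: "(\<Sum>m = 0..<2 * n. F (signed_point n m)) = (\<Sum>p\<in>points n. F p)"
  by (rule sum.reindex_bij_betw[OF bij_signed_point])

lemma signed_point_mem: "m < 2 * n \<Longrightarrow> signed_point n m \<in> points n"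
  using bij_betwE[OF bij_signed_point[of n]] by simp

lemma signed_action_mem:
  assumes "g \<in> carrier (hyperoctahedral n)" "p \<in> points n"
  shows "signed_action g p \<in> points n"
proof -
  obtain \<eta> \<pi> where g: "g = (\<eta>, \<pi>)" "\<pi> permutes {1..n}" using assms(1) by (auto simp: hyp_carrier)
  have "nat \<bar>p\<bar> \<in> {1..n}" using assms(2) by (auto simp: points_def)
  then have "\<pi> (nat \<bar>p\<bar>) \<in> {1..n}" by (simp only: permutes_in_image[OF g(2)])
  then show ?thesis using assms(2)
      by (auto simp: g(1) signed_action_def points_def abs_mult power_abs abs_sgn_eq sgn_eq_0_iff)
qed

text \<open>The second factor contributes the sign at \<open>?q\<close>, while the product is
  evaluated at \<open>\<pi> ?q\<close>; the twist of \<open>\<zeta>\<close> by the inverse of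
  \<open>\<pi>\<close> in the group law makes up for this.\<close>

lemma signed_action_mult:
  assumes "g \<in> carrier (hyperoctahedral n)" "h \<in> carrier (hyperoctahedral n)" "p \<in> points n"
  shows "signed_action (g \<otimes>\<^bsub>hyperoctahedral n\<^esub> h) p = signed_action g (signed_action h p)"
proof -
  obtain \<eta> \<pi> \<zeta> \<sigma> where g: "g = (\<eta>, \<pi>)" "\<pi> permutes {1..n}" and h: "h = (\<zeta>, \<sigma>)" "\<sigma> permutes {1..n}"
    using assms by (auto simp: hyp_carrier)
  let ?q = "\<sigma> (nat \<bar>p\<bar>)"
  have "nat \<bar>p\<bar> \<in> {1..n}" using assms(3) by (auto simp: points_def)
  then have q: "?q \<in> {1..n}" by (simp only: permutes_in_image[OF h(2)])
  then have "\<pi> ?q \<in> {1..n}" by (simp only: permutes_in_image[OF g(2)])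
  moreover have "nat \<bar>signed_action h p\<bar> = ?q" "sgn (signed_action h p) = (-1) ^ \<zeta> ?q * sgn p"
    using assms(3) q by (auto simp: h signed_action_def points_def abs_mult power_abs abs_sgn_eq sgn_mult power_sgn)
  moreover have "(-1::int) ^ (k mod 2) = (-1) ^ k" for k
    by (simp add: minus_one_power_iff even_iff_mod_2_eq_zero)
  moreover have "signed_action (g \<otimes>\<^bsub>hyperoctahedral n\<^esub> h) p
      = (-1) ^ ((\<eta> (\<pi> ?q) + \<zeta> ?q) mod 2) * sgn p * int (\<pi> ?q)"
    using \<open>\<pi> ?q \<in> {1..n}\<close>
        by (simp add: g(1) h(1) hyp_mult signed_action_def permutes_inverses[OF g(2)])
  moreover have "signed_action g k = (-1) ^ \<eta> (\<pi> (nat \<bar>k\<bar>)) * sgn k * int (\<pi> (nat \<bar>k\<bar>))" for k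
    by (simp add: g(1) signed_action_def)
  ultimately show ?thesis
    by (simp add: power_add)
qed

lemma signed_action_one: "p \<in> points n \<Longrightarrow> signed_action \<one>\<^bsub>hyperoctahedral n\<^esub> p = p"
  by (auto simp: signed_action_def hyp_one points_def sgn_if)

lemma representation_signed_perm_rep: "representation (hyperoctahedral n) (2
    * n) (signed_perm_rep n)"
  unfolding representation_def
proof (intro conjI ballI)
  show "signed_perm_rep n g \<in> carrier_mat (2 * n) (2 * n)" for g
    by (simp add: signed_perm_rep_def)
  have inj: "signed_point n i = signed_point n j \<longleftrightarrow> i = j" if "i < 2 * n" "j < 2 * n" for i j
    using inj_on_eq_iff[OF bij_betw_imp_inj_on[OF bij_signed_point[of n]]] that by simp
  show "signed_perm_rep n \<one>\<^bsub>hyperoctahedral n\<^esub> = 1\<^sub>m (2 * n)"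
    by (rule eq_matI) (auto simp: signed_perm_rep_def signed_action_one signed_point_mem inj)
  fix g h assume g: "g \<in> carrier (hyperoctahedral n)" and h: "h \<in> carrier (hyperoctahedral n)"
  show "signed_perm_rep n (g \<otimes>\<^bsub>hyperoctahedral n\<^esub> h) = signed_perm_rep n g * signed_perm_rep n h"
  proof (rule eq_matI)
    fix i j assume "i < dim_row (signed_perm_rep n g * signed_perm_rep n h)"
        "j < dim_col (signed_perm_rep n g * signed_perm_rep n h)"
    then have ij: "i < 2 * n" "j < 2 * n" by (auto simp: signed_perm_rep_def)
    let ?p = "signed_point n i" and ?r = "signed_action h (signed_point n j)"
    have r: "?r \<in> points n" using h ij by (intro signed_action_mem signed_point_mem)
    have "finite (points n)" using bij_betw_finite[OF bij_signed_point[of n]] by simp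
    have "(signed_perm_rep n g * signed_perm_rep n h) $$ (i, j)
        = (\<Sum>m = 0..<2 * n. (if ?p = signed_action g (signed_point n m) then 1 else 0)
            * (if signed_point n m = ?r then 1 else 0))"
      using ij by (simp add: signed_perm_rep_def scalar_prod_def)
    also have "\<dots> = (\<Sum>q\<in>points n. (if ?p = signed_action g q then 1 else 0) * (if q
        = ?r then 1 else 0))"
      by (rule sum_signed_point)
    also have "\<dots> = (\<Sum>q\<in>points n. if q = ?r then if ?p = signed_action g q then 1 else 0 else 0)"
      by (intro sum.cong refl) auto
    also have "\<dots> = (if ?p = signed_action g ?r then 1 else 0)"
      using r \<open>finite (points n)\<close> by simp
    finally show "signed_perm_rep n (g \<otimes>\<^bsub>hyperoctahedral n\<^esub> h) $$ (i, j) = (signed_perm_rep n g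
        * signed_perm_rep n h) $$ (i, j)"
      using ij g h by (simp add: signed_perm_rep_def signed_action_mult signed_point_mem)
  qed (auto simp: signed_perm_rep_def)
qed

lemma signed_action_sign_flip:
  assumes "p \<in> points n" "i \<in> {1..n}"
  shows "signed_action (sign_flip n i) p = (if \<bar>p\<bar> = int i then - p else p)"
proof -
  have "nat \<bar>p\<bar> \<in> {1..n}" using assms by (auto simp: points_def)
  moreover have "sgn p * \<bar>p\<bar> = p" by (simp add: sgn_mult_abs)
  ultimately show ?thesis by (auto simp: signed_action_def sign_flip_def)
qed

lemma signed_action_of_perm:
  assumes "p \<in> points n" "\<sigma> permutes {1..n}"
  shows "signed_action (of_perm n \<sigma>) p = sgn p * int (\<sigma> (nat \<bar>p\<bar>))"
proof -
  have "nat \<bar>p\<bar> \<in> {1..n}" using assms by (auto simp: points_def)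
  then have "\<sigma> (nat \<bar>p\<bar>) \<in> {1..n}" by (simp only: permutes_in_image[OF assms(2)])
  then show ?thesis by (simp add: signed_action_def of_perm_def)
qed

section \<open>Comparison of eigenvalues\<close>

lemma laplacian_mult_vec:
  assumes R: "\<And>h. h \<in> carrier G \<Longrightarrow> R h \<in> carrier_mat d d" and v: "v \<in> carrier_vec d" and i: "i < d"
  shows "(laplacian G w d R *\<^sub>v v) $ i = (\<Sum>h\<in>carrier G. w h * (v $ i - (R h *\<^sub>v v) $ i))"
proof -
  have "(laplacian G w d R *\<^sub>v v) $ i = (\<Sum>j = 0..<d. (\<Sum>h\<in>carrier G. w h * (1\<^sub>m d - R h) $$ (i, j))
      * v $ j)"
    using v i by (simp add: laplacian_def scalar_prod_def)
  also have "\<dots> = (\<Sum>h\<in>carrier G. \<Sum>j = 0..<d. w h * (1\<^sub>m d - R h) $$ (i, j) * v $ j)"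
    unfolding sum_distrib_right by (rule sum.swap)
  also have "\<dots> = (\<Sum>h\<in>carrier G. w h * (v $ i - (R h *\<^sub>v v) $ i))"
  proof (intro sum.cong refl)
    fix h assume "h \<in> carrier G"
    then have Rh: "R h \<in> carrier_mat d d" by (rule R)
    have "(\<Sum>j = 0..<d. w h * (1\<^sub>m d - R h) $$ (i, j) * v $ j)
        = (\<Sum>j = 0..<d. w h * ((if i = j then v $ j else 0) - R h $$ (i, j) * v $ j))"
      using Rh i by (intro sum.cong refl) (auto simp: algebra_simps)
    also have "\<dots> = w h * (v $ i - (\<Sum>j = 0..<d. R h $$ (i, j) * v $ j))"
      using i by (simp add: sum_distrib_left[symmetric] sum_subtractf)
    also have "(\<Sum>j = 0..<d. R h $$ (i, j) * v $ j) = (R h *\<^sub>v v) $ i"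
      using Rh v i by (simp add: scalar_prod_def)
    finally show "(\<Sum>j = 0..<d. w h * (1\<^sub>m d - R h) $$ (i, j) * v $ j) = w h * (v $ i
        - (R h *\<^sub>v v) $ i)" .
  qed
  finally show ?thesis .
qed

text \<open>Applying \<open>R g\<close> to the eigenvalue equation makes each entry of
  \<open>R g *\<^sub>v v\<close>, as a function of \<open>g\<close>, an eigenfunction of the
  Laplacian for right multiplication.\<close>

lemma matrix_coefficient_eigenfunction:
  assumes rep: "representation G d R" and ev: "eigenvector (laplacian G w d R) v k"
    and g: "g \<in> carrier G" and i: "i < d"
  shows "(\<Sum>h\<in>carrier G. w h * ((R g *\<^sub>v v) $ i - (R (g \<otimes>\<^bsub>G\<^esub> h) *\<^sub>v v) $ i)) = k * (R g *\<^sub>v v) $ i"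
proof -
  have R: "R h \<in> carrier_mat d d" if "h \<in> carrier G" for h
    using rep that by (simp add: representation_def)
  have v: "v \<in> carrier_vec d" and Lv: "laplacian G w d R *\<^sub>v v = k \<cdot>\<^sub>v v"
    using ev by (auto simp: eigenvector_def laplacian_def)
  have mv: "(R g *\<^sub>v u) $ i = (\<Sum>j = 0..<d. R g $$ (i, j) * u $ j)" if "u \<in> carrier_vec d" for u
    using R[OF g] i that by (simp add: scalar_prod_def)
  have "k * (R g *\<^sub>v v) $ i = (\<Sum>j = 0..<d. R g $$ (i, j) * (laplacian G w d R *\<^sub>v v) $ j)"
    using v by (simp add: mv Lv sum_distrib_left mult.left_commute)
  also have "\<dots> = (\<Sum>j = 0..<d. \<Sum>h\<in>carrier G. w h * (R g $$ (i, j) * v $ j - R g $$ (i, j)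
      * (R h *\<^sub>v v) $ j))"
    using R v by (intro sum.cong refl) (simp add: laplacian_mult_vec sum_distrib_left right_diff_distrib mult.left_commute)
  also have "\<dots> = (\<Sum>h\<in>carrier G. \<Sum>j = 0..<d. w h * (R g $$ (i, j) * v $ j - R g $$ (i, j)
      * (R h *\<^sub>v v) $ j))"
    by (rule sum.swap)
  also have "\<dots> = (\<Sum>h\<in>carrier G. w h * ((R g *\<^sub>v v) $ i - (R (g \<otimes>\<^bsub>G\<^esub> h) *\<^sub>v v) $ i))"
  proof (intro sum.cong refl)
    fix h assume h: "h \<in> carrier G"
    have "R (g \<otimes>\<^bsub>G\<^esub> h) = R g * R h" using rep g h by (simp add: representation_def)
    then have "R (g \<otimes>\<^bsub>G\<^esub> h) *\<^sub>v v = R g *\<^sub>v (R h *\<^sub>v v)"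
      using assoc_mult_mat_vec[OF R[OF g] R[OF h] v] by simp
    then show "(\<Sum>j = 0..<d. w h * (R g $$ (i, j) * v $ j - R g $$ (i, j) * (R h *\<^sub>v v) $ j))
        = w h * ((R g *\<^sub>v v) $ i - (R (g \<otimes>\<^bsub>G\<^esub> h) *\<^sub>v v) $ i)"
      using v R[OF h] by (simp add: mv sum_distrib_left[symmetric] sum_subtractf)
  qed
  finally show ?thesis by simp
qed

lemma finite_nontrivial_eigenvalues: "finite (nontrivial_eigenvalues G w d R)"
proof -
  let ?A = "laplacian G w d R"
  have A: "?A \<in> carrier_mat d d" by (simp add: laplacian_def)
  have "char_poly ?A \<noteq> 0" using degree_monic_char_poly[OF A] by auto
  then have "finite {z. poly (char_poly ?A) z = 0}" by (rule poly_roots_finite)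
  then have "finite (of_real -` {z. poly (char_poly ?A) z = 0} :: real set)"
    by (rule finite_vimageI) (simp add: inj_def)
  then show ?thesis
    by (rule finite_subset[rotated]) (auto simp: nontrivial_eigenvalues_def eigenvalue_root_char_poly[OF A])
qed

text \<open>Each edge is met twice in a sum over ordered pairs.\<close>

definition half_weight :: "(nat \<Rightarrow> nat \<Rightarrow> real) \<Rightarrow> nat \<Rightarrow> nat \<Rightarrow> real" where
  "half_weight b k l = (if k < l then b k l / 2 else if l < k then b l k / 2 else 0)"

lemma sum_half_weight:
  fixes Y :: "nat \<Rightarrow> nat \<Rightarrow> complex"
  assumes "\<And>k l. Y k l = Y l k"
  shows "(\<Sum>i\<in>{1..n}. \<Sum>j\<in>{i<..n}. complex_of_real (b i j) * Y i j)
    = (\<Sum>k\<in>{1..n}. \<Sum>l\<in>{1..n}. complex_of_real (half_weight b k l) * Y k l)"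
proof -
  define Z where "Z k l = (if k < l then complex_of_real (b k l / 2) * Y k l else 0)" for k l
  have "complex_of_real (half_weight b k l) * Y k l = Z k l + Z l k" for k l
    using assms[of k l] by (auto simp: half_weight_def Z_def)
  then have "(\<Sum>k\<in>{1..n}. \<Sum>l\<in>{1..n}. complex_of_real (half_weight b k l) * Y k l)
      = (\<Sum>k\<in>{1..n}. \<Sum>l\<in>{1..n}. Z k l) + (\<Sum>k\<in>{1..n}. \<Sum>l\<in>{1..n}. Z l k)"
    by (simp add: sum.distrib)
  also have "(\<Sum>k\<in>{1..n}. \<Sum>l\<in>{1..n}. Z l k) = (\<Sum>k\<in>{1..n}. \<Sum>l\<in>{1..n}. Z k l)"
    by (rule sum.swap)
  finally have split: "(\<Sum>k\<in>{1..n}. \<Sum>l\<in>{1..n}. complex_of_real (half_weight b k l) * Y k l)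
      = (\<Sum>k\<in>{1..n}. \<Sum>l\<in>{1..n}. Z k l) + (\<Sum>k\<in>{1..n}. \<Sum>l\<in>{1..n}. Z k l)" .
  have row: "(\<Sum>l\<in>{1..n}. Z k l) = (\<Sum>l\<in>{k<..n}. complex_of_real (b k l / 2) * Y k l)" if
      "k \<in> {1..n}" for k
    unfolding Z_def by (subst sum.inter_filter[symmetric]) (use that in \<open>auto intro!: sum.cong\<close>)
  then have "(\<Sum>k\<in>{1..n}. \<Sum>l\<in>{1..n}. Z k l) = (\<Sum>k\<in>{1..n}. \<Sum>l\<in>{k<..n}. complex_of_real (b k l / 2)
      * Y k l)"
    by (rule sum.cong[OF refl])
  then show ?thesis unfolding split by (simp add: sum.distrib[symmetric] mult.commute)
qed

text \<open>The function \<open>X\<close> is left free so that the rewriting applies both to the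
  Laplacian on vectors and to its counterpart on functions of the group.\<close>

lemma hyp_weight_sum:
  assumes w: "w = (\<lambda>g. (\<Sum>i\<in>{1..n}. complex_of_real (a i) * basis_elt (sign_flip n i) g)
      + (\<Sum>i\<in>{1..n}. \<Sum>j\<in>{i<..n}. complex_of_real (b i j) * basis_elt (of_perm n (tr i j)) g))"
  shows "(\<Sum>h\<in>carrier (hyperoctahedral n). w h * X h)
    = (\<Sum>i\<in>{1..n}. complex_of_real (a i) * X (sign_flip n i))
    + (\<Sum>k\<in>{1..n}. \<Sum>l\<in>{1..n}. complex_of_real (half_weight b k l) * X (of_perm n (tr k l)))"
proof -
  let ?C = "carrier (hyperoctahedral n)"
  have basis: "(\<Sum>h\<in>?C. basis_elt h0 h * X h) = X h0" if "h0 \<in> ?C" for h0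
  proof -
    have "(\<Sum>h\<in>?C. basis_elt h0 h * X h) = (\<Sum>h\<in>?C. if h = h0 then X h else 0)"
      by (intro sum.cong refl) (simp add: basis_elt_def)
    then show ?thesis using that finite_hyp by simp
  qed
  have "(\<Sum>h\<in>?C. w h * X h) = (\<Sum>h\<in>?C. \<Sum>i\<in>{1..n}. complex_of_real (a i)
      * (basis_elt (sign_flip n i) h * X h))
      + (\<Sum>h\<in>?C. \<Sum>i\<in>{1..n}. \<Sum>j\<in>{i<..n}. complex_of_real (b i j) * (basis_elt (of_perm n (tr i j)) h
          * X h))"
    by (simp add: w distrib_right sum.distrib sum_distrib_right mult.assoc)
  also have "(\<Sum>h\<in>?C. \<Sum>i\<in>{1..n}. complex_of_real (a i) * (basis_elt (sign_flip n i) h * X h))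
      = (\<Sum>i\<in>{1..n}. complex_of_real (a i) * X (sign_flip n i))"
    by (subst sum.swap) (simp add: sum_distrib_left[symmetric] basis sign_flip_carrier)
  also have "(\<Sum>h\<in>?C. \<Sum>i\<in>{1..n}. \<Sum>j\<in>{i<..n}. complex_of_real (b i j)
      * (basis_elt (of_perm n (tr i j)) h * X h))
      = (\<Sum>i\<in>{1..n}. \<Sum>j\<in>{i<..n}. complex_of_real (b i j) * X (of_perm n (tr i j)))"
  proof (subst sum.swap, rule sum.cong[OF refl], subst sum.swap, rule sum.cong[OF refl])
    fix i j assume "i \<in> {1..n}" "j \<in> {i<..n}"
    then have "of_perm n (tr i j) \<in> ?C" by (intro of_perm_carrier permutes_swap_id) auto
    then show "(\<Sum>h\<in>?C. complex_of_real (b i j) * (basis_elt (of_perm n (tr i j)) h * X h))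
      = complex_of_real (b i j) * X (of_perm n (tr i j))"
      by (simp add: sum_distrib_left[symmetric] basis)
  qed
  finally have main: "(\<Sum>h\<in>?C. w h * X h) = (\<Sum>i\<in>{1..n}. complex_of_real (a i) * X (sign_flip n i))
      + (\<Sum>i\<in>{1..n}. \<Sum>j\<in>{i<..n}. complex_of_real (b i j) * X (of_perm n (tr i j)))" .
  have "X (of_perm n (tr k l)) = X (of_perm n (tr l k))" for k l
    by (simp add: transpose_commute)
  then show ?thesis
    unfolding main by (simp only: sum_half_weight[of "\<lambda>k l. X (of_perm n (tr k l))"])
qed

text \<open>A permutation matrix acts on functions of the points by composition with the inverse;
  for an involution the inverse disappears.\<close>

lemma signed_perm_rep_mult_vec:
  assumes "h \<in> carrier (hyperoctahedral n)"
    and inv: "\<And>p. p \<in> points n \<Longrightarrow> signed_action h (signed_action h p) = p"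
  shows "signed_perm_rep n h *\<^sub>v vec (2 * n) (\<lambda>m. F (signed_point n m))
    = vec (2 * n) (\<lambda>m. F (signed_action h (signed_point n m)))"
proof (rule eq_vecI)
  fix m assume "m < dim_vec (vec (2 * n) (\<lambda>m. F (signed_action h (signed_point n m))))"
  then have m: "m < 2 * n" by simp
  let ?p = "signed_point n m"
  have p: "?p \<in> points n" "signed_action h ?p \<in> points n"
    using m assms(1) by (auto intro: signed_point_mem signed_action_mem)
  have fin: "finite (points n)" using bij_betw_finite[OF bij_signed_point[of n]] by simp
  have "(signed_perm_rep n h *\<^sub>v vec (2 * n) (\<lambda>m. F (signed_point n m))) $ m
      = (\<Sum>j = 0..<2 * n. (if ?p = signed_action h (signed_point n j) then 1 else 0)
          * F (signed_point n j))"
    using m by (simp add: signed_perm_rep_def scalar_prod_def)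
  also have "\<dots> = (\<Sum>q\<in>points n. (if ?p = signed_action h q then 1 else 0) * F q)"
    by (rule sum_signed_point)
  also have "\<dots> = (\<Sum>q\<in>points n. if q = signed_action h ?p then F q else 0)"
    using p inv by (intro sum.cong refl) auto
  also have "\<dots> = F (signed_action h ?p)" using p fin by simp
  finally show "(signed_perm_rep n h *\<^sub>v vec (2 * n) (\<lambda>m. F (signed_point n m))) $ m
      = vec (2 * n) (\<lambda>m. F (signed_action h (signed_point n m))) $ m"
    using m by simp
qed (simp add: signed_perm_rep_def)

lemma signed_action_involution:
  assumes "h \<otimes>\<^bsub>hyperoctahedral n\<^esub> h = \<one>\<^bsub>hyperoctahedral n\<^esub>" "h \<in> carrier (hyperoctahedral n)"
      "p \<in> points n"
  shows "signed_action h (signed_action h p) = p"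
  using signed_action_mult[OF assms(2,2,3)] signed_action_one[OF assms(3)] assms(1) by simp

lemma sign_flip_square: "i \<in> {1..n} \<Longrightarrow> sign_flip n i \<otimes>\<^bsub>hyperoctahedral n\<^esub> sign_flip n i
    = \<one>\<^bsub>hyperoctahedral n\<^esub>"
  by (subst (1) sign_flip_def) (auto simp: mult_sign_flip permutes_id hyp_one intro!: restrict_ext)

lemma of_perm_square:
  assumes "k \<in> {1..n}" "l \<in> {1..n}"
  shows "of_perm n (tr k l) \<otimes>\<^bsub>hyperoctahedral n\<^esub> of_perm n (tr k l) = \<one>\<^bsub>hyperoctahedral n\<^esub>"
  by (subst (1) of_perm_def, subst mult_of_perm) (use assms in \<open>auto simp: hyp_one permutes_swap_id\<close>)

section \<open>Odd and even eigenvectors, and comparison with an arbitrary eigenfunction\<close>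

context
  fixes n :: nat and a :: "nat \<Rightarrow> real" and b :: "nat \<Rightarrow> nat \<Rightarrow> real" and w ::
      "(nat \<Rightarrow> nat) \<times> (nat \<Rightarrow> nat) \<Rightarrow> complex"
  assumes w: "w = (\<lambda>g. (\<Sum>i\<in>{1..n}. complex_of_real (a i) * basis_elt (sign_flip n i) g)
      + (\<Sum>i\<in>{1..n}. \<Sum>j\<in>{i<..n}. complex_of_real (b i j) * basis_elt (of_perm n (tr i j)) g))"
begin

abbreviation (input) H where "H \<equiv> hyperoctahedral n"
abbreviation (input) c where "c \<equiv> half_weight b"

text \<open>The element \<open>h\<close> that changes \<open>F\<close> serves twice: it shows that
  the vector is nonzero and that it is not invariant.\<close>

lemma nontrivial_eigenvalue_signed:
  fixes F :: "int \<Rightarrow> real"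
  assumes eq: "\<And>p. p \<in> points n \<Longrightarrow>
      (\<Sum>i\<in>{1..n}. a i * (F p - F (signed_action (sign_flip n i) p)))
      + (\<Sum>k\<in>{1..n}. \<Sum>l\<in>{1..n}. c k l * (F p - F (signed_action (of_perm n (tr k l)) p))) = \<mu> * F p"
    and h: "h \<in> carrier H" "h \<otimes>\<^bsub>H\<^esub> h = \<one>\<^bsub>H\<^esub>" and p: "p \<in> points n" "F (signed_action h p) \<noteq> F p"
  shows "\<mu> \<in> nontrivial_eigenvalues H w (2 * n) (signed_perm_rep n)"
proof -
  define v where "v = vec (2 * n) (\<lambda>m. complex_of_real (F (signed_point n m)))"
  let ?L = "laplacian H w (2 * n) (signed_perm_rep n)"
  have act: "signed_perm_rep n h *\<^sub>v v = vec (2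
      * n) (\<lambda>m. complex_of_real (F (signed_action h (signed_point n m))))"
    if "h \<in> carrier H" "h \<otimes>\<^bsub>H\<^esub> h = \<one>\<^bsub>H\<^esub>" for h
    unfolding v_def using that signed_action_involution
    by (intro signed_perm_rep_mult_vec[where F = "\<lambda>p. complex_of_real (F p)"]) auto
  have moved: "signed_perm_rep n h *\<^sub>v v \<noteq> v"
  proof
    assume eqv: "signed_perm_rep n h *\<^sub>v v = v"
    obtain m where m: "m < 2 * n" "p = signed_point n m"
      using p(1) bij_betw_imp_surj_on[OF bij_signed_point[of n]] by force
    have "(signed_perm_rep n h *\<^sub>v v) $ m = v $ m" using eqv by simp
    then show False using act[OF h] m p(2) by (simp add: v_def)
  qed
  have "v \<noteq> 0\<^sub>v (2 * n)"
  proof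
    assume "v = 0\<^sub>v (2 * n)"
    then have "signed_perm_rep n h *\<^sub>v v = v" by (auto simp: signed_perm_rep_def)
    then show False using moved by simp
  qed
  moreover have "?L *\<^sub>v v = of_real \<mu> \<cdot>\<^sub>v v"
  proof (rule eq_vecI)
    fix m assume "m < dim_vec (of_real \<mu> \<cdot>\<^sub>v v)"
    then have m: "m < 2 * n" by (simp add: v_def)
    have "(?L *\<^sub>v v) $ m = (\<Sum>h\<in>carrier H. w h * (v $ m - (signed_perm_rep n h *\<^sub>v v) $ m))"
      using m by (intro laplacian_mult_vec) (auto simp: signed_perm_rep_def v_def)
    also have "\<dots> = (\<Sum>i\<in>{1..n}. complex_of_real (a i) * (v $ m
        - (signed_perm_rep n (sign_flip n i) *\<^sub>v v) $ m))
       + (\<Sum>k\<in>{1..n}. \<Sum>l\<in>{1..n}. complex_of_real (c k l) * (v $ m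
           - (signed_perm_rep n (of_perm n (tr k l)) *\<^sub>v v) $ m))"
      by (rule hyp_weight_sum[OF w])
    also have "\<dots> = complex_of_real ((\<Sum>i\<in>{1..n}. a i * (F (signed_point n m)
        - F (signed_action (sign_flip n i) (signed_point n m))))
      + (\<Sum>k\<in>{1..n}. \<Sum>l\<in>{1..n}. c k l * (F (signed_point n m)
          - F (signed_action (of_perm n (tr k l)) (signed_point n m)))))"
      unfolding of_real_add of_real_sum using m
      by (intro arg_cong2[where f = "(+)"] sum.cong refl)
        (simp_all add: act sign_flip_carrier sign_flip_square of_perm_carrier permutes_swap_id of_perm_square, simp_all add: v_def)
    also have "\<dots> = complex_of_real (\<mu> * F (signed_point n m))"
      using m by (simp only: eq[OF signed_point_mem])
    finally show "(?L *\<^sub>v v) $ m = (of_real \<mu> \<cdot>\<^sub>v v) $ m" using m by (simp add: v_def)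
  qed (simp add: v_def laplacian_def)
  ultimately have "eigenvector ?L v (of_real \<mu>)"
    by (auto simp: eigenvector_def laplacian_def v_def)
  then show ?thesis
    using moved h(1) by (auto simp: nontrivial_eigenvalues_def trivial_eigenvalue_def eigenvalue_def)
qed

lemma nat_abs_point: "p \<in> points n \<Longrightarrow> nat \<bar>p\<bar> \<in> {1..n}"
  by (auto simp: points_def)

text \<open>In the odd extension of \<open>z\<close> to the signed points, the one flip that moves
  \<open>p\<close> contributes \<open>2 * F p\<close>, which is the killing term. The flip at an
  index where \<open>z\<close> is nonzero moves the vector.\<close>

lemma odd_eigenvalue:
  assumes z: "\<And>i. i \<in> {1..n} \<Longrightarrow> killed_walk {1..n} a c z i = \<mu> * z i" and nz: "\<exists>i\<in>{1..n}. z i \<noteq> 0"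
  shows "\<mu> \<in> nontrivial_eigenvalues H w (2 * n) (signed_perm_rep n)"
proof -
  define F where "F p = of_int (sgn p) * z (nat \<bar>p\<bar>)" for p
  obtain i where i: "i \<in> {1..n}" "z i \<noteq> 0" using nz by blast
  have ip: "int i \<in> points n" using i by (auto simp: points_def)
  show ?thesis
  proof (rule nontrivial_eigenvalue_signed[of F \<mu> "sign_flip n i" "int i"])
    fix p assume p: "p \<in> points n"
    let ?m = "nat \<bar>p\<bar>"
    have m: "?m \<in> {1..n}" using p by (rule nat_abs_point)
    have "(\<Sum>j\<in>{1..n}. a j * (F p - F (signed_action (sign_flip n j) p))) = (\<Sum>j\<in>{1..n}. if j
        = ?m then 2 * a j * F p else 0)"
      using p by (intro sum.cong refl) (auto simp: signed_action_sign_flip F_def sgn_minus)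
    also have "\<dots> = 2 * a ?m * F p" using m by simp
    finally have 1: "(\<Sum>j\<in>{1..n}. a j * (F p - F (signed_action (sign_flip n j) p))) = 2 * a ?m
        * F p" .
    have 2: "c k l * (F p - F (signed_action (of_perm n (tr k l)) p)) = of_int (sgn p) * (c k l
        * (z ?m - z (tr k l ?m)))"
      if "k \<in> {1..n}" "l \<in> {1..n}" for k l
    proof -
      have perm: "tr k l permutes {1..n}" using that by (intro permutes_swap_id)
      then have "tr k l ?m \<in> {1..n}" using m by (simp only: permutes_in_image)
      then have "F (signed_action (of_perm n (tr k l)) p) = of_int (sgn p) * z (tr k l ?m)"
        using p by (simp add: signed_action_of_perm[OF p perm] F_def sgn_mult abs_mult abs_sgn_eq points_def)
      then show ?thesis by (simp add: F_def algebra_simps)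
    qed
    have "(\<Sum>k\<in>{1..n}. \<Sum>l\<in>{1..n}. c k l * (F p - F (signed_action (of_perm n (tr k l)) p)))
       = of_int (sgn p) * (\<Sum>k\<in>{1..n}. \<Sum>l\<in>{1..n}. c k l * (z ?m - z (tr k l ?m)))"
      unfolding sum_distrib_left by (intro sum.cong refl 2)
    then have "(\<Sum>j\<in>{1..n}. a j * (F p - F (signed_action (sign_flip n j) p)))
      + (\<Sum>k\<in>{1..n}. \<Sum>l\<in>{1..n}. c k l * (F p - F (signed_action (of_perm n (tr k l)) p)))
      = of_int (sgn p) * killed_walk {1..n} a c z ?m"
      unfolding 1 killed_walk_def by (simp add: F_def distrib_left)
    then show "(\<Sum>j\<in>{1..n}. a j * (F p - F (signed_action (sign_flip n j) p)))
      + (\<Sum>k\<in>{1..n}. \<Sum>l\<in>{1..n}. c k l * (F p - F (signed_action (of_perm n (tr k l)) p))) = \<mu> * F p"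
      by (simp only: z[OF m]) (simp add: F_def)
  qed (use i ip in \<open>auto simp: sign_flip_carrier sign_flip_square signed_action_sign_flip F_def\<close>)
qed

text \<open>The even extension of \<open>z\<close> is invariant under flips, whence the killing rate
  zero. Two different values are demanded because a constant function would be invariant under the
  group.\<close>

lemma even_eigenvalue:
  assumes z: "\<And>i. i \<in> {1..n} \<Longrightarrow> killed_walk {1..n} (\<lambda>_. 0) c z i = \<mu> * z i"
    and nz: "i \<in> {1..n}" "j \<in> {1..n}" "z i \<noteq> z j"
  shows "\<mu> \<in> nontrivial_eigenvalues H w (2 * n) (signed_perm_rep n)"
proof -
  define F where "F p = z (nat \<bar>p\<bar>)" for p
  have ip: "int i \<in> points n" using nz by (auto simp: points_def)
  have Fact: "F (signed_action (of_perm n (tr k l)) p) = z (tr k l (nat \<bar>p\<bar>))"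
    if "p \<in> points n" "k \<in> {1..n}" "l \<in> {1..n}" for k l p
    using that by (simp add: signed_action_of_perm permutes_swap_id F_def abs_mult abs_sgn_eq points_def)
  show ?thesis
  proof (rule nontrivial_eigenvalue_signed[of F \<mu> "of_perm n (tr i j)" "int i"])
    fix p assume p: "p \<in> points n"
    let ?m = "nat \<bar>p\<bar>"
    have m: "?m \<in> {1..n}" using p by (rule nat_abs_point)
    have 1: "(\<Sum>j\<in>{1..n}. a j * (F p - F (signed_action (sign_flip n j) p))) = 0"
      using p by (intro sum.neutral ballI) (auto simp: signed_action_sign_flip F_def)
    have "(\<Sum>k\<in>{1..n}. \<Sum>l\<in>{1..n}. c k l * (F p - F (signed_action (of_perm n (tr k l)) p)))
       = (\<Sum>k\<in>{1..n}. \<Sum>l\<in>{1..n}. c k l * (z ?m - z (tr k l ?m)))"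
      using p by (intro sum.cong refl) (simp add: Fact, simp add: F_def)
    then show "(\<Sum>j\<in>{1..n}. a j * (F p - F (signed_action (sign_flip n j) p)))
      + (\<Sum>k\<in>{1..n}. \<Sum>l\<in>{1..n}. c k l * (F p - F (signed_action (of_perm n (tr k l)) p))) = \<mu> * F p"
      using z[OF m] unfolding 1 killed_walk_def by (simp add: F_def)
  next
    have "F (signed_action (of_perm n (tr i j)) (int i)) = z j"
      using Fact[OF ip nz(1,2)] by simp
    then show "F (signed_action (of_perm n (tr i j)) (int i)) \<noteq> F (int i)"
      using nz(3) by (simp add: F_def)
  qed (use nz ip in \<open>auto simp: of_perm_carrier permutes_swap_id of_perm_square\<close>)
qed


lemma half_weight_sym: "c k l = c l k" by (simp add: half_weight_def)

text \<open>If some flip changes \<open>f\<close>, the energy bound compares \<open>x\<close> with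
  the killed walk. Otherwise \<open>f\<close> descends to the symmetric group, and
  \<open>interchange_gap\<close> compares \<open>x\<close> with the walk without killing.\<close>

lemma eigenvalue_le:
  fixes f :: "(nat \<Rightarrow> nat) \<times> (nat \<Rightarrow> nat) \<Rightarrow> real"
  assumes a: "\<And>i. i \<in> {1..n} \<Longrightarrow> a i \<ge> 0" and c: "\<And>k l. k \<in> {1..n} \<Longrightarrow> l \<in> {1..n} \<Longrightarrow> c k l \<ge> 0"
    and eq: "\<And>g. g \<in> carrier H \<Longrightarrow> (\<Sum>i\<in>{1..n}. a i * (f g - f (g \<otimes>\<^bsub>H\<^esub> sign_flip n i)))
      + (\<Sum>k\<in>{1..n}. \<Sum>l\<in>{1..n}. c k l * (f g - f (g \<otimes>\<^bsub>H\<^esub> of_perm n (tr k l)))) = x * f g"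
    and nonconst: "g1 \<in> carrier H" "g2 \<in> carrier H" "f g1 \<noteq> f g2"
  shows "\<exists>\<mu>\<in>nontrivial_eigenvalues H w (2 * n) (signed_perm_rep n). \<mu> \<le> x"
proof -
  define I where "I = {1..n}"
  define S where "S i g = g \<otimes>\<^bsub>H\<^esub> sign_flip n i" for i g
  define T where "T k l g = g \<otimes>\<^bsub>H\<^esub> of_perm n (tr k l)" for k l g
  interpret group H by (rule group_hyp)
  have flip: "sign_flip n i \<in> carrier H" if "i \<in> I" for i
    using that by (simp only: I_def sign_flip_carrier)
  have perm: "tr k l permutes {1..n}" "of_perm n (tr k l) \<in> carrier H" if "k \<in> I" "l \<in> I" for k l
    using that of_perm_carrier[OF permutes_swap_id] permutes_swap_id by (simp_all only: I_def)
  have closed: "S i g \<in> carrier H" "T k l g \<in> carrier H" if "g \<in> carrier H" "i \<in> I" "k \<in> I"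
      "l \<in> I" for i k l g
    using that flip perm by (auto simp: S_def T_def)
  have involutive: "S i (S i g) = g" "T k l (T k l g) = g" if "g \<in> carrier H" "i \<in> I" "k \<in> I"
      "l \<in> I" for i k l g
    using that flip perm sign_flip_square of_perm_square
        by (simp_all add: S_def T_def m_assoc I_def)
  have T_pair: "T k l (\<eta>, \<pi>) = (\<eta>, \<pi> \<circ> tr k l)" if "\<pi> permutes {1..n}" "\<eta> \<in> signs n" for k l \<eta> \<pi>
    unfolding T_def using that by (rule mult_of_perm)
  have S_pair: "S i (\<eta>, \<pi>) = (\<lambda>j\<in>{1..n}. (\<eta> j + (if j = \<pi> i then 1 else 0)) mod 2, \<pi>)"
    if "\<pi> permutes {1..n}" "i \<in> I" for i \<eta> \<pi>
    unfolding S_def using that by (simp only: I_def mult_sign_flip)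
  have carrierE: "\<exists>\<eta> \<pi>. g = (\<eta>, \<pi>) \<and> \<pi> permutes {1..n} \<and> \<eta> \<in> signs n" if "g \<in> carrier H" for g
    using that by (auto simp: hyp_carrier)
  have S_comm: "S i (S j g) = S j (S i g)" if "i \<in> I" "j \<in> I" "g \<in> carrier H" for i j g
    using carrierE[OF that(3)] that(1,2)
    by (auto simp: S_pair mod_add_left_eq intro!: restrict_ext)
  have T1: "T k k g = g" if "k \<in> I" "g \<in> carrier H" for k g
    using carrierE[OF that(2)] by (auto simp: T_pair)
  have ST: "S i (T k l g) = T k l (S (tr k l i) g)" if "i \<in> I" "k \<in> I" "l \<in> I" "g \<in> carrier H"
      for i k l g
  proof -
    have gH: "g \<in> carrier H" by (fact that(4))
    obtain \<eta> \<pi> where g: "g = (\<eta>, \<pi>)" "\<pi> permutes {1..n}" "\<eta> \<in> signs n" using carrierE[OF gH]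
        by blast
    have "tr k l i \<in> I" using that by (auto simp: Transposition.transpose_def)
    moreover have "\<pi> \<circ> tr k l permutes {1..n}" using g perm that by (intro permutes_compose)
    ultimately show ?thesis using g that
        by (simp add: S_pair T_pair[OF g(2) g(3)] T_pair[OF g(2) mod2_signs] del: One_nat_def)
  qed
  have eq': "(\<Sum>i\<in>I. a i * (f g - f (S i g))) + (\<Sum>k\<in>I. \<Sum>l\<in>I. c k l * (f g - f (T k l g))) = x * f g"
    if "g \<in> carrier H" for g
    unfolding I_def S_def T_def using that by (rule eq)
  show ?thesis
  proof (cases "\<exists>i\<in>I. \<exists>g\<in>carrier H. f (S i g) \<noteq> f g")
    case True
    then obtain i0 g0 where i0: "i0 \<in> I" "g0 \<in> carrier H" "f (S i0 g0) \<noteq> f g0" by blast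
    define y where "y i = L2_set (\<lambda>g. (f g - f (S i g)) / 2) (carrier H)" for i
    have "2 * (\<Sum>i\<in>I. a i * (y i)\<^sup>2) + (\<Sum>k\<in>I. \<Sum>l\<in>I. c k l * (y k - y l)\<^sup>2) \<le> x * (\<Sum>i\<in>I. (y i)\<^sup>2)"
      unfolding y_def
      by (rule killed_walk_energy_le[where T = T])
        (use finite_hyp closed involutive S_comm T1 ST eq' a c in \<open>auto simp: I_def\<close>)
    moreover have "y i0 \<noteq> 0"
      using i0 finite_hyp by (auto simp: y_def L2_set_eq_0_iff intro!: bexI[of _ g0])
    then have y0: "\<exists>i\<in>I. y i \<noteq> 0" using i0(1) by blast
    have fI: "finite I" by (simp add: I_def)
    obtain \<mu> z where z: "\<exists>i\<in>I. z i \<noteq> 0" "\<And>i. i \<in> I \<Longrightarrow> killed_walk I a c z i = \<mu> * z i"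
      and min: "\<mu> * (\<Sum>i\<in>I. (y i)\<^sup>2) \<le> 2 * (\<Sum>i\<in>I. a i * (y i)\<^sup>2) + (\<Sum>k\<in>I. \<Sum>l\<in>I. c k l * (y k
          - y l)\<^sup>2)"
      by (rule killed_walk_minimiser[of I a c "\<lambda>_. 0" y, OF fI _ _ y0]) (auto simp: killed_walk_def)
    ultimately have "\<mu> * (\<Sum>i\<in>I. (y i)\<^sup>2) \<le> x * (\<Sum>i\<in>I. (y i)\<^sup>2)" by linarith
    moreover have "(\<Sum>i\<in>I. (y i)\<^sup>2) > 0"
      using \<open>y i0 \<noteq> 0\<close> i0(1) fI by (intro sum_pos2[of _ i0]) auto
    ultimately have "\<mu> \<le> x" by simp
    moreover have "\<mu> \<in> nontrivial_eigenvalues H w (2 * n) (signed_perm_rep n)"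
      by (rule odd_eigenvalue) (use z in \<open>auto simp: I_def\<close>)
    ultimately show ?thesis by blast
  next
    case False
    then have inv: "f (S i g) = f g" if "i \<in> I" "g \<in> carrier H" for i g using that by blast
    define P where "P = {\<pi>. \<pi> permutes I}"
    define \<phi> where "\<phi> \<pi> = f (of_perm n \<pi>)" for \<pi>
    have finP: "finite P" by (simp add: P_def I_def finite_permutations)
    have f_phi: "f (\<eta>, \<pi>) = \<phi> \<pi>" if "\<eta> \<in> signs n" "\<pi> permutes {1..n}" for \<eta> \<pi>
      using that(1)
    proof (induction "card {j \<in> {1..n}. \<eta> j \<noteq> 0}" arbitrary: \<eta> rule: less_induct)
      case less
      show ?case
      proof (cases "\<exists>j\<in>{1..n}. \<eta> j \<noteq> 0")
        case True
        then obtain j where j: "j \<in> {1..n}" "\<eta> j \<noteq> 0" by blast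
        \<comment> \<open>A flip on the right acts at the image under \<open>\<pi>\<close>, so the
          sign at \<open>j\<close> is cleared by the flip at the preimage of
          \<open>j\<close>.\<close>
        define i where "i = inv_into UNIV \<pi> j"
        have i: "i \<in> I" "\<pi> i = j"
          using j permutes_inverses[OF that(2)] unfolding i_def I_def
          by (simp_all only: permutes_in_image[OF permutes_inv[OF that(2)]])
        define \<eta>' where "\<eta>' = (\<lambda>m\<in>{1..n}. (\<eta> m + (if m = j then 1 else 0)) mod 2)"
        have S: "S i (\<eta>, \<pi>) = (\<eta>', \<pi>)" using S_pair[OF that(2) i(1)] by (simp add: \<eta>'_def i(2))
        have "\<eta> j = 1" using j PiE_mem[OF less.prems j(1)] by auto
        then have "{m \<in> {1..n}. \<eta>' m \<noteq> 0} \<subset> {m \<in> {1..n}. \<eta> m \<noteq> 0}"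
        proof -
          have "\<eta>' m = (if m = j then 0 else \<eta> m)" if "m \<in> {1..n}" for m
            using that \<open>\<eta> j = 1\<close> signs_mod2[OF less.prems that] by (simp add: \<eta>'_def)
          then have "{m \<in> {1..n}. \<eta>' m \<noteq> 0} = {m. (m \<in> {1..n} \<and> \<eta> m \<noteq> 0) \<and> m \<noteq> j}"
            by (intro Collect_cong) metis
          then show ?thesis using j by blast
        qed
        then have "card {m \<in> {1..n}. \<eta>' m \<noteq> 0} < card {m \<in> {1..n}. \<eta> m \<noteq> 0}"
          by (intro psubset_card_mono) auto
        moreover have "\<eta>' \<in> signs n" unfolding \<eta>'_def by (rule mod2_signs)
        ultimately have "f (\<eta>', \<pi>) = \<phi> \<pi>" by (rule less.hyps)
        moreover have "f (S i (\<eta>, \<pi>)) = f (\<eta>, \<pi>)"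
          using i(1) less.prems that(2)
              by (intro inv) (simp_all only: hyp_carrier mem_Times_iff fst_conv snd_conv mem_Collect_eq simp_thms)
        ultimately show ?thesis by (simp add: S)
      next
        case False
        have "\<eta> = (\<lambda>j\<in>{1..n}. 0)"
        proof
          fix j
          show "\<eta> j = (\<lambda>j\<in>{1..n}. 0) j"
          proof (cases "j \<in> {1..n}")
            case True
            then show ?thesis using False by (simp only: restrict_apply') blast
          next
            case False
            then show ?thesis using PiE_arb[OF less.prems False] by (simp only: restrict_def
                if_False)
          qed
        qed
        then show ?thesis by (simp add: \<phi>_def of_perm_def)
      qed
    qed
    have phi_eq: "(\<Sum>k\<in>I. \<Sum>l\<in>I. c k l * (\<phi> \<pi> - \<phi> (\<pi> \<circ> tr k l))) = x * \<phi> \<pi>" if "\<pi> \<in> P" for \<pi>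
    proof -
      have \<pi>: "\<pi> permutes {1..n}" using that by (simp add: P_def I_def)
      have z: "(\<lambda>j\<in>{1..n}. 0) \<in> signs n" by auto
      have mem: "of_perm n \<pi> \<in> carrier H" using \<pi> by (rule of_perm_carrier)
      have "f (T k l (of_perm n \<pi>)) = \<phi> (\<pi> \<circ> tr k l)" for k l
        unfolding of_perm_def T_pair[OF \<pi> z] \<phi>_def ..
      then show ?thesis using eq'[OF mem] inv[OF _ mem] by (simp add: \<phi>_def)
    qed
    define N where "N = (\<Sum>\<pi>\<in>P. \<phi> \<pi>)"
    define m where "m = N / card P"
    define \<psi> where "\<psi> \<pi> = \<phi> \<pi> - m" for \<pi>
    have "id \<in> P" by (simp add: P_def permutes_id)
    then have cardP: "card P > 0" using finP by (auto simp: card_gt_0_iff)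
    have shift: "(\<Sum>\<pi>\<in>P. \<phi> (\<pi> \<circ> tr k l)) = N" if "k \<in> I" "l \<in> I" for k l
      unfolding N_def P_def using that by (rule sum_perm_tr)
    \<comment> \<open>The Laplacian of any function sums to zero, hence \<open>x * m = 0\<close>,
      and subtracting the mean keeps the eigenvalue equation even when \<open>x = 0\<close>.\<close>
    have "x * N = (\<Sum>\<pi>\<in>P. \<Sum>k\<in>I. \<Sum>l\<in>I. c k l * (\<phi> \<pi> - \<phi> (\<pi> \<circ> tr k l)))"
      by (simp add: N_def sum_distrib_left phi_eq)
    also have "\<dots> = (\<Sum>k\<in>I. \<Sum>l\<in>I. \<Sum>\<pi>\<in>P. c k l * (\<phi> \<pi> - \<phi> (\<pi> \<circ> tr k l)))"
      by (subst sum.swap, rule sum.cong[OF refl], rule sum.swap)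
    also have "\<dots> = 0"
      by (simp add: sum_distrib_left[symmetric] sum_subtractf shift N_def[symmetric])
    finally have "x * m = 0" by (simp add: m_def)
    then have psi_eq: "(\<Sum>k\<in>I. \<Sum>l\<in>I. c k l * (\<psi> \<pi> - \<psi> (\<pi> \<circ> tr k l))) = x * \<psi> \<pi>" if "\<pi> \<in> P" for \<pi>
      using phi_eq[OF that] by (simp add: \<psi>_def right_diff_distrib[of x])
    have psi0: "(\<Sum>\<pi>\<in>P. \<psi> \<pi>) = 0" using cardP by (simp add: \<psi>_def sum_subtractf m_def N_def)
    have psi_ne: "\<exists>\<pi>\<in>P. \<psi> \<pi> \<noteq> 0"
    proof (rule ccontr)
      assume "\<not> ?thesis"
      then have const: "\<phi> \<pi> = m" if "\<pi> permutes {1..n}" for \<pi> using that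
          by (simp add: \<psi>_def P_def I_def)
      have "f g = m" if "g \<in> carrier H" for g
        using carrierE[OF that] f_phi const by auto
      then show False using nonconst by simp
    qed
    then have pos: "(\<Sum>\<pi>\<in>P. (\<psi> \<pi>)\<^sup>2) > 0"
      using finP by (metis sum_pos2 zero_le_power2 zero_less_power2)
    have form: "2 * x * (\<Sum>\<pi>\<in>P. (\<psi> \<pi>)\<^sup>2) = (\<Sum>k\<in>I. \<Sum>l\<in>I. c k l * swap_energy I \<psi> k l)"
    proof -
      have "x * (\<Sum>\<pi>\<in>P. (\<psi> \<pi>)\<^sup>2) = (\<Sum>\<pi>\<in>P. \<psi> \<pi> * (x * \<psi> \<pi>))"
        by (simp add: sum_distrib_left power2_eq_square mult.left_commute)
      also have "\<dots> = (\<Sum>\<pi>\<in>P. \<Sum>k\<in>I. \<Sum>l\<in>I. c k l * (\<psi> \<pi> * (\<psi> \<pi> - \<psi> (\<pi> \<circ> tr k l))))"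
        by (intro sum.cong refl) (simp only: psi_eq[symmetric] sum_distrib_left mult.left_commute)
      also have "\<dots> = (\<Sum>k\<in>I. \<Sum>l\<in>I. \<Sum>\<pi>\<in>P. c k l * (\<psi> \<pi> * (\<psi> \<pi> - \<psi> (\<pi> \<circ> tr k l))))"
        by (subst sum.swap, rule sum.cong[OF refl], rule sum.swap)
      also have "\<dots> = (\<Sum>k\<in>I. \<Sum>l\<in>I. c k l * (swap_energy I \<psi> k l / 2))"
        by (intro sum.cong refl) (simp add: sum_distrib_left[symmetric] P_def swap_energy_form)
      finally show ?thesis by (simp add: sum_divide_distrib[symmetric])
    qed
    have fI: "finite I" by (simp add: I_def)
    \<comment> \<open>A nonzero function of mean zero needs more than one permutation. Two points
      then provide the nonzero mean-zero vector \<open>z0\<close> required for the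
      minimiser.\<close>
    have "n \<ge> 2"
    proof (rule ccontr)
      assume "\<not> n \<ge> 2"
      then have "I = {} \<or> I = {1}" by (auto simp: I_def)
      then have "P = {id}" by (auto simp: P_def permutes_sing)
      then show False using psi0 psi_ne by simp
    qed
    define z0 where "z0 i = (if i = 1 then 1 else if i = 2 then -1 else 0 :: real)" for i :: nat
    have z0: "(\<Sum>i\<in>I. z0 i * 1) = 0" "\<exists>i\<in>I. z0 i \<noteq> 0"
    proof -
      have "(\<Sum>i\<in>I. z0 i) = (\<Sum>i\<in>{1,2}. z0 i)"
        using \<open>n \<ge> 2\<close> by (intro sum.mono_neutral_right) (auto simp: I_def z0_def)
      then show "(\<Sum>i\<in>I. z0 i * 1) = 0" by (simp add: z0_def)
      show "\<exists>i\<in>I. z0 i \<noteq> 0" using \<open>n \<ge> 2\<close> by (intro bexI[of _ 1]) (auto simp: z0_def I_def)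
    qed
    obtain \<mu> z where z: "\<exists>i\<in>I. z i \<noteq> 0" "(\<Sum>i\<in>I. z i * 1) = 0" "\<And>i. i \<in> I
        \<Longrightarrow> killed_walk I (\<lambda>_. 0) c z i = \<mu> * z i"
      and min: "\<And>y. (\<Sum>i\<in>I. y i * 1) = 0 \<Longrightarrow> \<mu> * (\<Sum>i\<in>I. (y i)\<^sup>2) \<le> 2 * (\<Sum>i\<in>I. 0 * (y i)\<^sup>2)
          + (\<Sum>k\<in>I. \<Sum>l\<in>I. c k l * (y k - y l)\<^sup>2)"
      by (rule killed_walk_minimiser[of I "\<lambda>_. 0" c
          "\<lambda>_. 1" z0, OF fI _ z0]) (auto simp: killed_walk_def)
    \<comment> \<open>Here \<open>lam\<close> is the minimal Rayleigh quotient of the random walk on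
      mean-zero vectors.\<close>
    have "2 * \<mu> * (\<Sum>\<pi> | \<pi> permutes I. (\<psi> \<pi>)\<^sup>2) \<le> (\<Sum>k\<in>I. \<Sum>l\<in>I. c k l * swap_energy I \<psi> k l)"
      by (rule interchange_gap) (use fI c min psi0 half_weight_sym in \<open>auto simp: I_def P_def\<close>)
    then have "2 * \<mu> * (\<Sum>\<pi>\<in>P. (\<psi> \<pi>)\<^sup>2) \<le> 2 * x * (\<Sum>\<pi>\<in>P. (\<psi> \<pi>)\<^sup>2)"
      by (simp only: form P_def[symmetric])
    then have "2 * \<mu> \<le> 2 * x" using pos by (rule mult_right_le_imp_le)
    then have "\<mu> \<le> x" by simp
    moreover have "\<exists>i\<in>I. \<exists>j\<in>I. z i \<noteq> z j"
    proof (rule ccontr)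
      assume neg: "\<not> ?thesis"
      obtain i where i: "i \<in> I" "z i \<noteq> 0" using z(1) by blast
      have "z j * 1 = z i" if "j \<in> I" for j using neg i(1) that by (metis mult.right_neutral)
      then have "(\<Sum>j\<in>I. z j * 1) = (\<Sum>j\<in>I. z i)" by (rule sum.cong[OF refl])
      also have "\<dots> = card I * z i" by simp
      finally show False using z(2) i fI by auto
    qed
    then have "\<mu> \<in> nontrivial_eigenvalues H w (2 * n) (signed_perm_rep n)"
      using even_eigenvalue[of z \<mu>] z(3) by (auto simp: I_def)
    ultimately show ?thesis by blast
  qed
qed

end

theorem theorem1p2:
  fixes n :: nat
    and a :: "nat \<Rightarrow> real"
    and b :: "nat \<Rightarrow> nat \<Rightarrow> real"
    and w :: "(nat \<Rightarrow> nat) \<times> (nat \<Rightarrow> nat) \<Rightarrow> complex"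
  assumes "n \<ge> 1"
    and "\<And>i. 1 \<le> i \<Longrightarrow> i \<le> n \<Longrightarrow> a i \<ge> 0"
    and "\<And>i j. 1 \<le> i \<Longrightarrow> i < j \<Longrightarrow> j \<le> n \<Longrightarrow> b i j \<ge> 0"
    and "w = (\<lambda>g. (\<Sum>i\<in>{1..n}. complex_of_real (a i) * basis_elt (sign_flip n i) g)
                + (\<Sum>i\<in>{1..n}. \<Sum>j\<in>{i<..n}. complex_of_real (b i j) *
                     basis_elt (of_perm n (Transposition.transpose i j)) g))"
  shows "psi (hyperoctahedral n) w = psi_rep (hyperoctahedral n) w (2 * n) (signed_perm_rep n)"
proof (rule antisym)
  let ?H = "hyperoctahedral n" and ?P = "signed_perm_rep n"
  show "psi ?H w \<le> psi_rep ?H w (2 * n) ?P"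
    unfolding psi_def using representation_signed_perm_rep by (intro Inf_lower) blast
  have "psi_rep ?H w (2 * n) ?P \<le> psi_rep ?H w d R" if rep: "representation ?H d R" for d R
  proof (cases "nontrivial_eigenvalues ?H w d R = {}")
    case False
    define x where "x = Min (nontrivial_eigenvalues ?H w d R)"
    have "x \<in> nontrivial_eigenvalues ?H w d R"
      unfolding x_def using False finite_nontrivial_eigenvalues by (rule Min_in[rotated])
    then obtain v g where v: "eigenvector (laplacian ?H w d R) v (of_real x)" and g:
        "g \<in> carrier ?H" "R g *\<^sub>v v \<noteq> v"
      by (auto simp: nontrivial_eigenvalues_def trivial_eigenvalue_def)
    have R: "R h \<in> carrier_mat d d" if "h \<in> carrier ?H" for h
      using rep that by (simp add: representation_def)
    have vd: "v \<in> carrier_vec d" using v by (auto simp: eigenvector_def laplacian_def)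
    \<comment> \<open>A coordinate in which \<open>R g\<close> moves \<open>v\<close> gives a
      nonconstant matrix coefficient.\<close>
    obtain i where i: "i < d" "(R g *\<^sub>v v) $ i \<noteq> v $ i"
      using g R[OF g(1)] vd by (metis carrier_matD(1) carrier_vecD dim_mult_mat_vec eq_vecI)
    define F where "F h = (R h *\<^sub>v v) $ i" for h
    interpret group ?H by (rule group_hyp)
    have one: "\<one>\<^bsub>?H\<^esub> \<in> carrier ?H" by simp
    have F1: "F \<one>\<^bsub>?H\<^esub> = v $ i" using rep vd by (simp add: F_def representation_def)
    have eq: "(\<Sum>i\<in>{1..n}. complex_of_real (a i) * (F h - F (h \<otimes>\<^bsub>?H\<^esub> sign_flip n i)))
      + (\<Sum>k\<in>{1..n}. \<Sum>l\<in>{1..n}. complex_of_real (half_weight b k l) * (F h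
          - F (h \<otimes>\<^bsub>?H\<^esub> of_perm n (tr k l))))
      = of_real x * F h" if "h \<in> carrier ?H" for h
      using matrix_coefficient_eigenfunction[OF rep v that i(1)]
      unfolding F_def[symmetric] hyp_weight_sum[OF assms(4), where X = "\<lambda>h'. F h
          - F (h \<otimes>\<^bsub>?H\<^esub> h')"] .
    \<comment> \<open>The weights and \<open>x\<close> are real, so the real and imaginary parts of
      \<open>F\<close> satisfy the equation separately, and at least one of them is
      nonconstant.\<close>
    have "Re (F g) \<noteq> Re (F \<one>\<^bsub>?H\<^esub>) \<or> Im (F g) \<noteq> Im (F \<one>\<^bsub>?H\<^esub>)"
      using i(2) F1 by (auto simp: F_def complex_eq_iff)
    then obtain f :: "_ \<Rightarrow> real" where f: "f = (\<lambda>h. Re (F h)) \<or> f = (\<lambda>h. Im (F h))" "f g \<noteq> f \<one>\<^bsub>?H\<^esub>"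
      by metis
    have "\<exists>\<mu>\<in>nontrivial_eigenvalues ?H w (2 * n) ?P. \<mu> \<le> x"
    proof (rule eigenvalue_le[OF assms(4) _ _ _ g(1) one f(2)])
      fix h assume h: "h \<in> carrier ?H"
      show "(\<Sum>i\<in>{1..n}. a i * (f h - f (h \<otimes>\<^bsub>?H\<^esub> sign_flip n i)))
        + (\<Sum>k\<in>{1..n}. \<Sum>l\<in>{1..n}. half_weight b k l * (f h - f (h \<otimes>\<^bsub>?H\<^esub> of_perm n (tr k l)))) = x
            * f h"
        using f(1) arg_cong[OF eq[OF h], of Re] arg_cong[OF eq[OF h], of Im] by auto
    qed (use assms(2,3) in \<open>auto simp: half_weight_def\<close>)
    then obtain \<mu> where \<mu>: "\<mu> \<in> nontrivial_eigenvalues ?H w (2 * n) ?P" "\<mu> \<le> x" by blast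
    then have "psi_rep ?H w (2 * n) ?P \<le> ereal \<mu>"
      by (auto simp: psi_rep_def intro: Min_le finite_nontrivial_eigenvalues)
    also have "\<dots> \<le> psi_rep ?H w d R" using \<mu>(2) False by (simp add: psi_rep_def x_def)
    finally show ?thesis .
  qed (simp add: psi_rep_def)
  then show "psi_rep ?H w (2 * n) ?P \<le> psi ?H w"
    unfolding psi_def by (auto intro: Inf_greatest)
qed

end
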